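(* All Massey products (triple and higher) on the cdga $B$ constructed in the context vanish, i.e. whenever homogeneous classes $x_1,\dots,x_m\in H(B)$, $m\ge3$, have a defined Massey product, $0\in\langle x_1,\dots,x_m\rangle$.
   Context: Everything is over $\mathbb{Q}$; $\Lambda(\cdot)$ denotes the free graded-commutative algebra. Construction of $A$. $A=(\Lambda V,d)$ with $V^{\le5}$ having basis: degree 2: $X,Y$ with $dX=dY=0$; degree 3: $a,b,c$ with $da=X^2$, $db=XY$, $dc=Y^2$; degree 4: $e,f$ with $de=Ya-Xb$, $df=Yb-Xc$; degree 5: $h,i$ with $dh=Xe+ab$, $di=Yf+bc$. The space $V^{\ge6}$ is constructed inductively so as to kill all cohomology in degrees $\ge7$: choose cocycles representing a basis of degree $7$ cohomology, introduce for each of them a generator in $V^6$ mapped by $d$ to that cocycle, and repeat for degrees $8,9,\dots$ with generators in $V^7,V^8,\dots$. Put $m=Ye+ac+Xf$. Construction of $B$. $B=(A\otimes\Lambda W,d)$, containing $A$ as a sub-cdga, with $W^{\le5}$ having basis: degree 3: $\alpha,\gamma$ with $d\alpha=d\gamma=0$; degree 4: $s_{X\alpha},s_{Y\alpha},s_{X\gamma},s_{Y\gamma}$ with $ds_{X\alpha}=X\alpha$, $ds_{Y\alpha}=Y\alpha$, $ds_{X\gamma}=X\gamma$, $ds_{Y\gamma}=Y\gamma$; degree 5: $t_1,\dots,t_9$ with $dt_i=v_i$, where $v_1=m-\alpha\gamma$, $v_2=Ys_{X\alpha}-Xs_{Y\alpha}$, $v_3=Ys_{X\gamma}-Xs_{Y\gamma}$,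 $v_4=a\alpha-Xs_{X\alpha}$, $v_5=b\alpha-Xs_{Y\alpha}$, $v_6=c\alpha-Ys_{Y\alpha}$, $v_7=a\gamma-Xs_{X\gamma}$, $v_8=b\gamma-Xs_{Y\gamma}$, $v_9=c\gamma-Ys_{Y\gamma}$. The space $W^{\ge6}$ is constructed in the same inductive way, killing all cohomology in degrees $\ge7$, so that $H^{\ge7}(B)=0$. Massey products: for homogeneous classes $x_1,\dots,x_m\in H(B)$, $m\ge 3$, a defining system consists of homogeneous elements $a_{i,j}$, $0\le i<j\le m$, $(i,j)\neq(0,m)$, where $a_{i-1,i}$ is a closed representative of $x_i$ and $da_{i,j}=\sum_{i<l<j}\bar a_{i,l}a_{l,j}$ for $j-i\ge2$, with $\bar a=(-1)^{|a|+1}a$. It yields the class $[\sum_{0<l<m}\bar a_{0,l}a_{l,m}]$. The Massey product $\langle x_1,\dots,x_m\rangle$ is the set of all classes so obtained; it is defined if a defining system exists, and it vanishes if it contains $0$. *)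

theory Defs
  imports Complex_Main "HOL-Library.Poly_Mapping" "HOL-Library.Multiset" "HOL-Library.Nat_Bijection"
begin

section \<open>Free graded-commutative algebras over the rationals\<close>

text \<open>
  A type of class \<open>graded_gens\<close> is a totally ordered set of homogeneous generators. The order is
  only used to choose a normal form for monomials. A monomial is the multiset of its factors;
  generators of odd degree square to zero, so they occur at most once.
\<close>

class graded_gens = linorder +
  fixes gdeg :: "'a \<Rightarrow> nat"

definition monomial :: "'g::graded_gens multiset \<Rightarrow> bool" where
  "monomial M \<longleftrightarrow> (\<forall>x. odd (gdeg x) \<longrightarrow> count M x \<le> 1)"

definition mdeg :: "'g::graded_gens multiset \<Rightarrow> nat" where
  "mdeg M = (\<Sum>x\<in>#M. gdeg x)"

definition inversions :: "'g::graded_gens multiset \<Rightarrow> 'g multiset \<Rightarrow> ('g \<times> 'g) set" where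
  "inversions M N = {(x, y). x \<in># M \<and> y \<in># N \<and> odd (gdeg x) \<and> odd (gdeg y) \<and> y < x}"

text \<open>
  The normally ordered monomials \<open>M\<close> and \<open>N\<close> have product \<open>koszul M N\<close> times the normally ordered
  monomial \<open>M + N\<close>: the sign is that of the permutation sorting the odd factors, and the product
  is zero if an odd generator occurs in both.
\<close>

definition koszul :: "'g::graded_gens multiset \<Rightarrow> 'g multiset \<Rightarrow> rat" where
  "koszul M N = (if monomial (M + N) then (-1) ^ card (inversions M N) else 0)"

definition raw_mult ::
  "('g::graded_gens multiset \<Rightarrow>\<^sub>0 rat) \<Rightarrow> ('g multiset \<Rightarrow>\<^sub>0 rat) \<Rightarrow> ('g multiset \<Rightarrow>\<^sub>0 rat)" where
  "raw_mult p q = (\<Sum>M\<in>Poly_Mapping.keys p. \<Sum>N\<in>Poly_Mapping.keys q.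
     Poly_Mapping.single (M + N)
       (koszul M N * Poly_Mapping.lookup p M * Poly_Mapping.lookup q N))"

lemma finite_inversions: "finite (inversions M N)"
  by (rule finite_subset[of _ "set_mset M \<times> set_mset N"]) (auto simp: inversions_def)

lemma monomial_empty [simp]: "monomial {#}"
  by (simp add: monomial_def)

lemma monomial_add_left: "monomial (M + N) \<Longrightarrow> monomial M"
  and monomial_add_right: "monomial (M + N) \<Longrightarrow> monomial N"
  unfolding monomial_def count_union by (meson add_leD1 add_leD2)+

lemma monomial_add_disjoint:
  assumes "monomial (M + N)" "odd (gdeg x)" "x \<in># M"
  shows "x \<notin># N"
proof
  assume "x \<in># N"
  with assms(3) have "count M x \<ge> 1" "count N x \<ge> 1" by (simp_all add: Suc_leI)
  moreover have "count M x + count N x \<le> 1"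
    using assms(1,2) by (simp add: monomial_def)
  ultimately show False by linarith
qed

lemma card_inversions_add_left:
  assumes "monomial (M + N)"
  shows "card (inversions (M + N) K) = card (inversions M K) + card (inversions N K)"
proof -
  have "inversions (M + N) K = inversions M K \<union> inversions N K"
    by (auto simp: inversions_def)
  moreover have "inversions M K \<inter> inversions N K = {}"
    using monomial_add_disjoint[OF assms] by (auto simp: inversions_def)
  ultimately show ?thesis by (simp add: card_Un_disjoint finite_inversions)
qed

lemma card_inversions_add_right:
  assumes "monomial (M + N)"
  shows "card (inversions K (M + N)) = card (inversions K M) + card (inversions K N)"
proof -
  have "inversions K (M + N) = inversions K M \<union> inversions K N"
    by (auto simp: inversions_def)
  moreover have "inversions K M \<inter> inversions K N = {}"
    using monomial_add_disjoint[OF assms] by (auto simp: inversions_def)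
  ultimately show ?thesis by (simp add: card_Un_disjoint finite_inversions)
qed

lemma koszul_assoc: "koszul M N * koszul (M + N) K = koszul N K * koszul M (N + K)"
proof (cases "monomial (M + N + K)")
  case True
  then have *: "monomial (M + N)" "monomial (N + K)" "monomial (M + (N + K))"
    using monomial_add_left monomial_add_right by (metis add.assoc)+
  then show ?thesis
    using True by (simp add: koszul_def card_inversions_add_left card_inversions_add_right power_add)
next
  case False
  then show ?thesis by (simp add: koszul_def add.assoc)
qed

lemma koszul_empty: "koszul {#} M = (if monomial M then 1 else 0)"
  "koszul M {#} = (if monomial M then 1 else 0)"
  by (auto simp: koszul_def inversions_def)

lemma raw_mult_superset:
  assumes "finite S" "Poly_Mapping.keys p \<subseteq> S" "finite T" "Poly_Mapping.keys q \<subseteq> T"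
  shows "raw_mult p q = (\<Sum>M\<in>S. \<Sum>N\<in>T. Poly_Mapping.single (M + N)
       (koszul M N * Poly_Mapping.lookup p M * Poly_Mapping.lookup q N))"
proof -
  have "raw_mult p q = (\<Sum>M\<in>Poly_Mapping.keys p. \<Sum>N\<in>T. Poly_Mapping.single (M + N)
       (koszul M N * Poly_Mapping.lookup p M * Poly_Mapping.lookup q N))"
    unfolding raw_mult_def
    by (intro sum.cong refl sum.mono_neutral_left assms) (auto simp: in_keys_iff)
  also have "\<dots> = (\<Sum>M\<in>S. \<Sum>N\<in>T. Poly_Mapping.single (M + N)
       (koszul M N * Poly_Mapping.lookup p M * Poly_Mapping.lookup q N))"
    by (intro sum.mono_neutral_left assms) (auto simp: in_keys_iff)
  finally show ?thesis .
qed

lemma raw_mult_add_left: "raw_mult (p + p') q = raw_mult p q + raw_mult p' q"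
proof -
  let ?S = "Poly_Mapping.keys p \<union> Poly_Mapping.keys p'"
  have k: "Poly_Mapping.keys (p + p') \<subseteq> ?S" by (rule Poly_Mapping.keys_add)
  show ?thesis
    by (subst (1 2 3) raw_mult_superset[where S = ?S and T = "Poly_Mapping.keys q"])
      (use k in \<open>auto simp: lookup_add algebra_simps single_add sum.distrib\<close>)
qed

lemma raw_mult_add_right: "raw_mult q (p + p') = raw_mult q p + raw_mult q p'"
proof -
  let ?S = "Poly_Mapping.keys p \<union> Poly_Mapping.keys p'"
  have k: "Poly_Mapping.keys (p + p') \<subseteq> ?S" by (rule Poly_Mapping.keys_add)
  show ?thesis
    by (subst (1 2 3) raw_mult_superset[where T = ?S and S = "Poly_Mapping.keys q"])
      (use k in \<open>auto simp: lookup_add algebra_simps single_add sum.distrib\<close>)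
qed

lemma raw_mult_single:
  "raw_mult (Poly_Mapping.single M u) (Poly_Mapping.single N v)
     = Poly_Mapping.single (M + N) (koszul M N * u * v)"
  by (subst raw_mult_superset[where S = "{M}" and T = "{N}"]) (auto split: if_splits)

lemma sum_singles:
  fixes p :: "'a \<Rightarrow>\<^sub>0 'b::comm_monoid_add"
  shows "(\<Sum>M\<in>Poly_Mapping.keys p. Poly_Mapping.single M (Poly_Mapping.lookup p M)) = p"
proof (rule poly_mapping_eqI)
  fix N
  show "Poly_Mapping.lookup
      (\<Sum>M\<in>Poly_Mapping.keys p. Poly_Mapping.single M (Poly_Mapping.lookup p M)) N
    = Poly_Mapping.lookup p N"
    by (cases "N \<in> Poly_Mapping.keys p")
      (auto simp: lookup_sum lookup_single when_def in_keys_iff sum.delta)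
qed

lemma single_sum_induct [case_names single sum]:
  fixes p :: "'a \<Rightarrow>\<^sub>0 'b::comm_monoid_add"
  assumes single: "\<And>M u. P (Poly_Mapping.single M u)"
    and add: "\<And>p q. P p \<Longrightarrow> P q \<Longrightarrow> P (p + q)"
  shows "P p"
proof -
  have "P (\<Sum>M\<in>S. Poly_Mapping.single M (Poly_Mapping.lookup p M))" if "finite S" for S
    using that by (induction S rule: finite_induct) (use single[of undefined 0] in \<open>auto intro: single add\<close>)
  from this[of "Poly_Mapping.keys p"] show ?thesis by (simp add: sum_singles)
qed

lemma raw_mult_assoc: "raw_mult (raw_mult p q) r = raw_mult p (raw_mult q r)"
proof (induction p rule: single_sum_induct)
  case (sum p1 p2)
  then show ?case by (simp add: raw_mult_add_left)
next
  case P: (single M u)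
  show ?case
  proof (induction q rule: single_sum_induct)
    case (sum q1 q2)
    then show ?case by (simp add: raw_mult_add_left raw_mult_add_right)
  next
    case Q: (single N v)
    show ?case
    proof (induction r rule: single_sum_induct)
      case (sum r1 r2)
      then show ?case by (simp add: raw_mult_add_right)
    next
      case (single K w)
      show ?case
        using koszul_assoc[of M N K]
        by (simp add: raw_mult_single add.assoc mult.assoc mult.left_commute)
          (metis (no_types, lifting) mult.assoc mult.commute)
    qed
  qed
qed

lemma keys_raw_mult: "M \<in> Poly_Mapping.keys (raw_mult p q) \<Longrightarrow> monomial M"
proof -
  assume "M \<in> Poly_Mapping.keys (raw_mult p q)"
  then obtain K L where
    "M \<in> Poly_Mapping.keys (Poly_Mapping.single (K + L)
       (koszul K L * Poly_Mapping.lookup p K * Poly_Mapping.lookup q L))"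
    unfolding raw_mult_def by (blast dest: subsetD[OF keys_sum])
  then show "monomial M" by (auto simp: koszul_def split: if_splits)
qed

typedef (overloaded) 'g fgca =
  "{p :: 'g::graded_gens multiset \<Rightarrow>\<^sub>0 rat. \<forall>M\<in>Poly_Mapping.keys p. monomial M}"
  morphisms fgca_coeffs Abs_fgca
  by (rule exI[of _ 0]) simp

setup_lifting type_definition_fgca

instantiation fgca :: (graded_gens) ring_1
begin

lift_definition zero_fgca :: "'a fgca" is 0 by simp
lift_definition one_fgca :: "'a fgca" is "Poly_Mapping.single {#} 1" by simp
lift_definition plus_fgca :: "'a fgca \<Rightarrow> 'a fgca \<Rightarrow> 'a fgca" is "(+)"
  by (blast dest: subsetD[OF Poly_Mapping.keys_add])
lift_definition uminus_fgca :: "'a fgca \<Rightarrow> 'a fgca" is uminus by simp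
lift_definition minus_fgca :: "'a fgca \<Rightarrow> 'a fgca \<Rightarrow> 'a fgca" is "(-)"
  by (blast dest: subsetD[OF Poly_Mapping.keys_diff])
lift_definition times_fgca :: "'a fgca \<Rightarrow> 'a fgca \<Rightarrow> 'a fgca" is raw_mult
  by (blast dest: keys_raw_mult)

instance
proof
  fix x y z :: "'a fgca"
  show "x + y + z = x + (y + z)" "x + y = y + x" "0 + x = x" "- x + x = 0" "x - y = x + - y"
    by (transfer; simp add: algebra_simps)+
  show "x * y * z = x * (y * z)" by transfer (rule raw_mult_assoc)
  show "(x + y) * z = x * z + y * z" by transfer (rule raw_mult_add_left)
  show "x * (y + z) = x * y + x * z" by transfer (rule raw_mult_add_right)
  show "1 * x = x"
  proof transfer
    fix p :: "'a multiset \<Rightarrow>\<^sub>0 rat" assume "\<forall>M\<in>Poly_Mapping.keys p. monomial M"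
    then have "raw_mult (Poly_Mapping.single {#} 1) p
        = (\<Sum>M\<in>Poly_Mapping.keys p. Poly_Mapping.single M (Poly_Mapping.lookup p M))"
      by (subst raw_mult_superset[where S = "{{#}}" and T = "Poly_Mapping.keys p"])
        (auto simp: koszul_empty)
    then show "raw_mult (Poly_Mapping.single {#} 1) p = p"
      by (simp add: sum_singles)
  qed
  show "x * 1 = x"
  proof transfer
    fix p :: "'a multiset \<Rightarrow>\<^sub>0 rat" assume "\<forall>M\<in>Poly_Mapping.keys p. monomial M"
    then have "raw_mult p (Poly_Mapping.single {#} 1)
        = (\<Sum>M\<in>Poly_Mapping.keys p. Poly_Mapping.single M (Poly_Mapping.lookup p M))"
      by (subst raw_mult_superset[where T = "{{#}}" and S = "Poly_Mapping.keys p"])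
        (auto simp: koszul_empty)
    then show "raw_mult p (Poly_Mapping.single {#} 1) = p"
      by (simp add: sum_singles)
  qed
  show "(0 :: 'a fgca) \<noteq> 1"
    by transfer (metis lookup_single_eq lookup_zero zero_neq_one)
qed

end

lift_definition smult :: "rat \<Rightarrow> 'g::graded_gens fgca \<Rightarrow> 'g fgca" is
  "\<lambda>c. Poly_Mapping.map ((*) c)"
  by (auto simp: in_keys_iff Poly_Mapping.map.rep_eq when_def split: if_splits)

lift_definition gen :: "'g::graded_gens \<Rightarrow> 'g fgca" is "\<lambda>x. Poly_Mapping.single {#x#} 1"
  by (auto simp: monomial_def)

definition support :: "'g::graded_gens fgca \<Rightarrow> 'g multiset set" where
  "support u = Poly_Mapping.keys (fgca_coeffs u)"

definition Lam :: "'g::graded_gens set \<Rightarrow> 'g fgca set" where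
  "Lam G = {u. \<forall>M\<in>support u. set_mset M \<subseteq> G}"

definition homog :: "nat \<Rightarrow> 'g::graded_gens fgca \<Rightarrow> bool" where
  "homog n u \<longleftrightarrow> (\<forall>M\<in>support u. mdeg M = n)"

text \<open>The linear map which is \<open>(-1) ^ (n + 1)\<close> on elements of degree \<open>n\<close>.\<close>

lift_definition bar :: "'g::graded_gens fgca \<Rightarrow> 'g fgca" is
  "Poly_Mapping.mapp (\<lambda>M c. (-1) ^ (mdeg M + 1) * c)"
  by (auto simp: in_keys_iff lookup_mapp when_def split: if_splits)


section \<open>Differentials, cohomology and Massey products\<close>

text \<open>
  A cdga is given by a graded subalgebra \<open>C\<close> of the form \<open>Lam G\<close> together with a map \<open>d\<close>, of which only
  the values on \<open>C\<close> matter.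
\<close>

definition differential_on :: "'g::graded_gens fgca set \<Rightarrow> ('g fgca \<Rightarrow> 'g fgca) \<Rightarrow> bool" where
  "differential_on C d \<longleftrightarrow>
     (\<forall>u\<in>C. d u \<in> C) \<and>
     (\<forall>u\<in>C. \<forall>v\<in>C. d (u + v) = d u + d v) \<and>
     (\<forall>c. \<forall>u\<in>C. d (smult c u) = smult c (d u)) \<and>
     (\<forall>n. \<forall>u\<in>C. homog n u \<longrightarrow> homog (n + 1) (d u)) \<and>
     (\<forall>n. \<forall>u\<in>C. \<forall>v\<in>C. homog n u \<longrightarrow> d (u * v) = d u * v + (-1) ^ n * u * d v) \<and>
     (\<forall>u\<in>C. d (d u) = 0)"

definition cocycles :: "'g::graded_gens fgca set \<Rightarrow> ('g fgca \<Rightarrow> 'g fgca) \<Rightarrow> nat \<Rightarrow> 'g fgca set" where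
  "cocycles C d n = {z \<in> C. homog n z \<and> d z = 0}"

definition coboundaries :: "'g::graded_gens fgca set \<Rightarrow> ('g fgca \<Rightarrow> 'g fgca) \<Rightarrow> 'g fgca set" where
  "coboundaries C d = d ` C"

definition cohom_class ::
  "'g::graded_gens fgca set \<Rightarrow> ('g fgca \<Rightarrow> 'g fgca) \<Rightarrow> 'g fgca \<Rightarrow> 'g fgca set" where
  "cohom_class C d z = {z + b | b. b \<in> coboundaries C d}"

definition homog_classes ::
  "'g::graded_gens fgca set \<Rightarrow> ('g fgca \<Rightarrow> 'g fgca) \<Rightarrow> 'g fgca set set" where
  "homog_classes C d = (\<Union>n. cohom_class C d ` cocycles C d n)"

text \<open>
  The \<open>z k\<close> with \<open>k \<in> K\<close> are cocycles whose classes form a basis of the degree \<open>n\<close> cohomology.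
\<close>

definition represents_basis ::
  "'g::graded_gens fgca set \<Rightarrow> ('g fgca \<Rightarrow> 'g fgca) \<Rightarrow> nat \<Rightarrow> 'k set \<Rightarrow> ('k \<Rightarrow> 'g fgca) \<Rightarrow> bool" where
  "represents_basis C d n K z \<longleftrightarrow>
     (\<forall>k\<in>K. z k \<in> cocycles C d n) \<and>
     (\<forall>F c. finite F \<and> F \<subseteq> K \<and> (\<Sum>k\<in>F. smult (c k) (z k)) \<in> coboundaries C d
        \<longrightarrow> (\<forall>k\<in>F. c k = 0)) \<and>
     (\<forall>w\<in>cocycles C d n. \<exists>F c. finite F \<and> F \<subseteq> K \<and>
        w - (\<Sum>k\<in>F. smult (c k) (z k)) \<in> coboundaries C d)"

text \<open>
  The classes \<open>x\<^sub>1, \<dots>, x\<^sub>m\<close> are given by the values of \<open>x\<close> on \<open>{1..m}\<close>.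
\<close>

definition defining_system ::
  "'g::graded_gens fgca set \<Rightarrow> ('g fgca \<Rightarrow> 'g fgca) \<Rightarrow> nat \<Rightarrow> (nat \<Rightarrow> 'g fgca set)
     \<Rightarrow> (nat \<Rightarrow> nat \<Rightarrow> 'g fgca) \<Rightarrow> bool" where
  "defining_system C d m x a \<longleftrightarrow>
     (\<forall>i j. i < j \<and> j \<le> m \<and> (i, j) \<noteq> (0, m) \<longrightarrow> a i j \<in> C \<and> (\<exists>n. homog n (a i j))) \<and>
     (\<forall>i\<in>{1..m}. d (a (i - 1) i) = 0 \<and> cohom_class C d (a (i - 1) i) = x i) \<and>
     (\<forall>i j. i + 2 \<le> j \<and> j \<le> m \<and> (i, j) \<noteq> (0, m) \<longrightarrow>
        d (a i j) = (\<Sum>l\<in>{i<..<j}. bar (a i l) * a l j))"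

definition massey_product ::
  "'g::graded_gens fgca set \<Rightarrow> ('g fgca \<Rightarrow> 'g fgca) \<Rightarrow> nat \<Rightarrow> (nat \<Rightarrow> 'g fgca set)
     \<Rightarrow> 'g fgca set set" where
  "massey_product C d m x =
     {cohom_class C d (\<Sum>l\<in>{0<..<m}. bar (a 0 l) * a l m) | a. defining_system C d m x a}"

definition massey_defined ::
  "'g::graded_gens fgca set \<Rightarrow> ('g fgca \<Rightarrow> 'g fgca) \<Rightarrow> nat \<Rightarrow> (nat \<Rightarrow> 'g fgca set) \<Rightarrow> bool" where
  "massey_defined C d m x \<longleftrightarrow> (\<exists>a. defining_system C d m x a)"

definition massey_vanishes ::
  "'g::graded_gens fgca set \<Rightarrow> ('g fgca \<Rightarrow> 'g fgca) \<Rightarrow> nat \<Rightarrow> (nat \<Rightarrow> 'g fgca set) \<Rightarrow> bool" where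
  "massey_vanishes C d m x \<longleftrightarrow> cohom_class C d 0 \<in> massey_product C d m x"


section \<open>The algebras A and B\<close>

text \<open>
  \<open>Vg n k\<close> and \<open>Wg n k\<close> are potential generators of degree \<open>n\<close> for the inductive part of the
  construction. They are used for \<open>n \<ge> 6\<close> and for \<open>k\<close> in an index set depending on \<open>n\<close>.
\<close>

datatype bgen =
    Xg | Yg | ag | bg | cg | eg | fg | hg | ig | Vg nat nat
  | alphag | gammag | sXalphag | sYalphag | sXgammag | sYgammag | tg nat | Wg nat nat

fun bcode :: "bgen \<Rightarrow> nat" where
  "bcode Xg = 0" | "bcode Yg = 1" | "bcode ag = 2" | "bcode bg = 3" | "bcode cg = 4"
| "bcode eg = 5" | "bcode fg = 6" | "bcode hg = 7" | "bcode ig = 8"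
| "bcode alphag = 9" | "bcode gammag = 10"
| "bcode sXalphag = 11" | "bcode sYalphag = 12" | "bcode sXgammag = 13" | "bcode sYgammag = 14"
| "bcode (tg k) = 3 * k + 15"
| "bcode (Vg n k) = 3 * prod_encode (n, k) + 16"
| "bcode (Wg n k) = 3 * prod_encode (n, k) + 17"

lemma bcode_inject: "bcode x = bcode y \<Longrightarrow> x = y"
  by (cases x; cases y; simp; presburger?)

instantiation bgen :: graded_gens
begin

definition less_eq_bgen :: "bgen \<Rightarrow> bgen \<Rightarrow> bool" where
  "x \<le> y \<longleftrightarrow> bcode x \<le> bcode y"

definition less_bgen :: "bgen \<Rightarrow> bgen \<Rightarrow> bool" where
  "x < y \<longleftrightarrow> bcode x < bcode y"

fun gdeg_bgen :: "bgen \<Rightarrow> nat" where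
  "gdeg_bgen Xg = 2" | "gdeg_bgen Yg = 2"
| "gdeg_bgen ag = 3" | "gdeg_bgen bg = 3" | "gdeg_bgen cg = 3"
| "gdeg_bgen eg = 4" | "gdeg_bgen fg = 4"
| "gdeg_bgen hg = 5" | "gdeg_bgen ig = 5"
| "gdeg_bgen (Vg n k) = n"
| "gdeg_bgen alphag = 3" | "gdeg_bgen gammag = 3"
| "gdeg_bgen sXalphag = 4" | "gdeg_bgen sYalphag = 4"
| "gdeg_bgen sXgammag = 4" | "gdeg_bgen sYgammag = 4"
| "gdeg_bgen (tg k) = 5"
| "gdeg_bgen (Wg n k) = n"

instance
  by standard (auto simp: less_eq_bgen_def less_bgen_def intro: bcode_inject)

end

definition V_gens :: "(nat \<Rightarrow> nat set) \<Rightarrow> bgen set" where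
  "V_gens I = {Xg, Yg, ag, bg, cg, eg, fg, hg, ig} \<union> {Vg n k | n k. n \<ge> 6 \<and> k \<in> I n}"

definition W_gens :: "(nat \<Rightarrow> nat set) \<Rightarrow> bgen set" where
  "W_gens J = {alphag, gammag, sXalphag, sYalphag, sXgammag, sYgammag} \<union> {tg k | k. k \<in> {1..9}}
     \<union> {Wg n k | n k. n \<ge> 6 \<and> k \<in> J n}"

definition gens_below :: "nat \<Rightarrow> 'g::graded_gens set \<Rightarrow> 'g set" where
  "gens_below n G = {x \<in> G. gdeg x < n}"

abbreviation "eX \<equiv> gen Xg"
abbreviation "eY \<equiv> gen Yg"
abbreviation "ea \<equiv> gen ag"
abbreviation "eb \<equiv> gen bg"
abbreviation "ec \<equiv> gen cg"
abbreviation "ee \<equiv> gen eg"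
abbreviation "ef \<equiv> gen fg"
abbreviation "eh \<equiv> gen hg"
abbreviation "ei \<equiv> gen ig"
abbreviation "ealpha \<equiv> gen alphag"
abbreviation "egamma \<equiv> gen gammag"
abbreviation "esXalpha \<equiv> gen sXalphag"
abbreviation "esYalpha \<equiv> gen sYalphag"
abbreviation "esXgamma \<equiv> gen sXgammag"
abbreviation "esYgamma \<equiv> gen sYgammag"

definition em :: "bgen fgca" where
  "em = eY * ee + ea * ec + eX * ef"

text \<open>
  \<open>constructs_A I d\<close>: the cdga \<open>(Lam (V_gens I), d)\<close> arises from the construction of \<open>A\<close>, with
  the elements of \<open>I n\<close> indexing the generators added in degree \<open>n \<ge> 6\<close>.
\<close>

definition constructs_A :: "(nat \<Rightarrow> nat set) \<Rightarrow> (bgen fgca \<Rightarrow> bgen fgca) \<Rightarrow> bool" where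
  "constructs_A I d \<longleftrightarrow>
     differential_on (Lam (V_gens I)) d \<and>
     d eX = 0 \<and> d eY = 0 \<and>
     d ea = eX * eX \<and> d eb = eX * eY \<and> d ec = eY * eY \<and>
     d ee = eY * ea - eX * eb \<and> d ef = eY * eb - eX * ec \<and>
     d eh = eX * ee + ea * eb \<and> d ei = eY * ef + eb * ec \<and>
     (\<forall>n\<ge>6. represents_basis (Lam (gens_below n (V_gens I))) d (n + 1) (I n)
        (\<lambda>k. d (gen (Vg n k))))"

definition constructs_B ::
  "(nat \<Rightarrow> nat set) \<Rightarrow> (nat \<Rightarrow> nat set) \<Rightarrow> (bgen fgca \<Rightarrow> bgen fgca) \<Rightarrow> bool" where
  "constructs_B I J d \<longleftrightarrow>
     constructs_A I d \<and>
     differential_on (Lam (V_gens I \<union> W_gens J)) d \<and>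
     d ealpha = 0 \<and> d egamma = 0 \<and>
     d esXalpha = eX * ealpha \<and> d esYalpha = eY * ealpha \<and>
     d esXgamma = eX * egamma \<and> d esYgamma = eY * egamma \<and>
     d (gen (tg 1)) = em - ealpha * egamma \<and>
     d (gen (tg 2)) = eY * esXalpha - eX * esYalpha \<and>
     d (gen (tg 3)) = eY * esXgamma - eX * esYgamma \<and>
     d (gen (tg 4)) = ea * ealpha - eX * esXalpha \<and>
     d (gen (tg 5)) = eb * ealpha - eX * esYalpha \<and>
     d (gen (tg 6)) = ec * ealpha - eY * esYalpha \<and>
     d (gen (tg 7)) = ea * egamma - eX * esXgamma \<and>
     d (gen (tg 8)) = eb * egamma - eX * esYgamma \<and>
     d (gen (tg 9)) = ec * egamma - eY * esYgamma \<and>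
     (\<forall>n\<ge>6. represents_basis (Lam (V_gens I \<union> gens_below n (W_gens J))) d (n + 1) (J n)
        (\<lambda>k. d (gen (Wg n k))))"

end

theory Submission
  imports Defs
begin

text \<open>
  In degrees up to six the cohomology of \<open>B\<close> is spanned by the classes of \<open>1\<close>, \<open>X\<close>, \<open>Y\<close>, \<open>\<alpha>\<close>, \<open>\<gamma>\<close>
  and \<open>\<alpha>\<gamma>\<close>, and it vanishes in higher degrees. A Massey product containing the class zero vanishes,
  and one containing a class of degree zero has a vanishing factor next to it. Hence all degrees may
  be assumed to be at least two, and then the product has degree five (where it vanishes), degree
  six, or degree at least seven (where it vanishes). In degree six there are only the triple
  products of two classes of degree two and one of degree three, which vanish because of \<open>t\<^sub>2, \<dots>, t\<^sub>9\<close>, and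
  the quadruple products of classes of degree two, where adding multiples of \<open>\<alpha>\<close> and \<open>\<gamma>\<close> to the
  entries of a defining system produces an arbitrary multiple of \<open>\<alpha>\<gamma>\<close>.
\<close>

section \<open>Coefficients and monomials\<close>

text \<open>Classes of degrees \<open>n_k\<close> have a product of degree two plus the sum of all
  \<open>n_k - 1\<close>, which explains the bound five and leaves four patterns of degrees for six.
  This count presupposes that each entry of a defining system has the degree it ought to have. The
  definition asks only for some degree, so the systems have to be normalised; that rests on the fact
  that two nonzero elements of degree two have a nonzero product. The generator \<open>tg 1\<close>
  does not kill the cocycle \<open>em\<close> of A but makes it cohomologous to a product of two
  classes. Such a product can be absorbed: changing two entries of a defining system by closed
  elements of degree three changes the quadruple product by their product and by cross terms with
  the old entries. The remaining \<open>tg k\<close> make these cross terms exact.\<close>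

lift_definition coeff :: "'g::graded_gens fgca \<Rightarrow> 'g multiset \<Rightarrow> rat" is Poly_Mapping.lookup .

lemma fgca_eqI: "(\<And>M. coeff u M = coeff v M) \<Longrightarrow> u = v"
  by transfer (rule poly_mapping_eqI)

lemma coeff_zero [simp]: "coeff 0 M = 0"
  by transfer simp

lemma coeff_add [simp]: "coeff (u + v) M = coeff u M + coeff v M"
  by transfer (simp add: lookup_add)

lemma coeff_uminus [simp]: "coeff (- u) M = - coeff u M"
  by transfer simp

lemma coeff_diff [simp]: "coeff (u - v) M = coeff u M - coeff v M"
  by transfer (simp add: lookup_minus)

lemma coeff_smult [simp]: "coeff (smult c u) M = c * coeff u M"
  by transfer (simp add: Poly_Mapping.map.rep_eq when_def)

lemma coeff_sum [simp]: "coeff (sum f A) M = (\<Sum>i\<in>A. coeff (f i) M)"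
  by (induction A rule: infinite_finite_induct) auto

lemma coeff_bar [simp]: "coeff (bar u) M = (-1) ^ (mdeg M + 1) * coeff u M"
  by transfer (simp add: lookup_mapp when_def in_keys_iff)

lemma mem_support [simp]: "M \<in> support u \<longleftrightarrow> coeff u M \<noteq> 0"
  unfolding support_def by transfer (simp add: in_keys_iff)

lemma finite_support [simp]: "finite (support u)"
  unfolding support_def by simp

lemma coeff_not_monomial: "\<not> monomial M \<Longrightarrow> coeff u M = 0"
  by transfer (auto simp: in_keys_iff)

text \<open>Total in \<open>M\<close>, with value 0 when an odd generator is repeated, so that
  \<open>mult_mon\<close> holds without side conditions.\<close>

lift_definition mon :: "'g::graded_gens multiset \<Rightarrow> 'g fgca" is
  "\<lambda>M. if monomial M then Poly_Mapping.single M 1 else 0"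
  by (auto split: if_splits)

lemma coeff_mon: "coeff (mon M) N = (if M = N \<and> monomial M then 1 else 0)"
  by transfer (simp add: lookup_single when_def)

lemma mon_empty: "mon {#} = 1"
  by transfer simp

lemma gen_eq_mon: "gen x = mon {#x#}"
  by transfer (simp add: monomial_def)

lemma smult_simps:
  "smult c (u + v) = smult c u + smult c v"
  "smult c (u - v) = smult c u - smult c v"
  "smult c (- u) = - smult c u"
  "smult c 0 = 0"
  "smult 0 u = 0"
  "smult 1 u = u"
  "smult c (smult c' u) = smult (c * c') u"
  "smult (- c) u = - smult c u"
  by (rule fgca_eqI; simp add: algebra_simps)+

lemma smult_add_left: "smult (c + c') u = smult c u + smult c' u"
  by (rule fgca_eqI) (simp add: algebra_simps)

lemma fgca_expand: "u = (\<Sum>M\<in>support u. smult (coeff u M) (mon M))"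
proof (rule fgca_eqI)
  fix N
  have "coeff (\<Sum>M\<in>support u. smult (coeff u M) (mon M)) N
      = (\<Sum>M\<in>support u. if M = N then coeff u M else 0)"
    unfolding coeff_sum coeff_smult
    by (intro sum.cong) (auto simp: coeff_mon dest: coeff_not_monomial)
  then show "coeff u N = coeff (\<Sum>M\<in>support u. smult (coeff u M) (mon M)) N"
    by (auto simp: sum.delta')
qed

lemma fgca_induct [case_names mon add]:
  assumes "\<And>c M. monomial M \<Longrightarrow> P (smult c (mon M))" "\<And>u v. P u \<Longrightarrow> P v \<Longrightarrow> P (u + v)"
  shows "P u"
proof -
  have "P (\<Sum>M\<in>S. smult (coeff u M) (mon M))" if "finite S" "S \<subseteq> support u" for S
    using that
  proof (induction S rule: finite_induct)
    case empty
    then show ?case using assms(1)[of "{#}" 0] by (simp add: smult_simps)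
  next
    case (insert M S)
    have "coeff u M \<noteq> 0" using insert.prems by auto
    then have "monomial M" using coeff_not_monomial by blast
    then show ?case using insert by (auto intro: assms)
  qed
  from this[of "support u"] show ?thesis by (simp flip: fgca_expand)
qed

lemma mult_smult [simp]:
  "smult c u * v = smult c (u * v)" "u * smult c v = smult c (u * v)"
proof -
  have "raw_mult (Poly_Mapping.map ((*) c) p) q = Poly_Mapping.map ((*) c) (raw_mult p q)
    \<and> raw_mult p (Poly_Mapping.map ((*) c) q) = Poly_Mapping.map ((*) c) (raw_mult p q)"
    for c and p q :: "'a multiset \<Rightarrow>\<^sub>0 rat"
  proof (cases "c = 0")
    case True
    then have "Poly_Mapping.map ((*) c) r = 0" for r :: "'a multiset \<Rightarrow>\<^sub>0 rat"
      by (intro poly_mapping_eqI) (simp add: Poly_Mapping.map.rep_eq when_def)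
    then show ?thesis by (simp add: raw_mult_def)
  next
    case False
    have map_add: "Poly_Mapping.map ((*) c) (r + s)
        = Poly_Mapping.map ((*) c) r + Poly_Mapping.map ((*) c) s" for r s :: "'a multiset \<Rightarrow>\<^sub>0 rat"
      by (intro poly_mapping_eqI)
        (auto simp: Poly_Mapping.map.rep_eq when_def lookup_add simp flip: distrib_left)
    have map_single: "Poly_Mapping.map ((*) c) (Poly_Mapping.single M u)
        = Poly_Mapping.single M (c * u)" for M :: "'a multiset" and u
      by (intro poly_mapping_eqI)
        (simp add: Poly_Mapping.map.rep_eq when_def lookup_single)
    show ?thesis
    proof (induction p rule: single_sum_induct)
      case (sum p1 p2)
      then show ?case by (simp add: raw_mult_add_left map_add)
    next
      case P: (single M u)
      show ?case
      proof (induction q rule: single_sum_induct)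
        case (sum q1 q2)
        then show ?case by (simp add: raw_mult_add_right map_add)
      next
        case (single N v)
        show ?case by (simp add: raw_mult_single map_single mult_ac)
      qed
    qed
  qed
  note raw = this
  show "smult c u * v = smult c (u * v)" by transfer (use raw in blast)
  show "u * smult c v = smult c (u * v)" by transfer (use raw in blast)
qed

lemma mult_mon: "mon M * mon N = smult (koszul M N) (mon (M + N))"
proof (cases "monomial M \<and> monomial N")
  case True
  then show ?thesis
    by transfer (auto intro!: poly_mapping_eqI
        simp: raw_mult_single Poly_Mapping.map.rep_eq lookup_single when_def koszul_def)
next
  case False
  then have "\<not> monomial (M + N)"
    using monomial_add_left monomial_add_right by blast
  moreover have "mon M = 0 \<or> mon N = 0"
    using False by (metis coeff_mon coeff_zero fgca_eqI)
  ultimately show ?thesis by (auto simp: koszul_def smult_simps)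
qed

lemma support_mult:
  assumes "coeff (u * v) M \<noteq> 0"
  obtains K L where "coeff u K \<noteq> 0" "coeff v L \<noteq> 0" "M = K + L"
proof -
  have "u * v = (\<Sum>K\<in>support u. smult (coeff u K) (mon K))
      * (\<Sum>L\<in>support v. smult (coeff v L) (mon L))"
    by (simp flip: fgca_expand)
  also have "\<dots> = (\<Sum>K\<in>support u. \<Sum>L\<in>support v.
      smult (coeff u K * coeff v L * koszul K L) (mon (K + L)))"
    by (simp add: sum_product mult_mon smult_simps mult_ac)
  finally have "u * v = \<dots>" .
  then have "(\<Sum>K\<in>support u. \<Sum>L\<in>support v.
      coeff u K * coeff v L * koszul K L * coeff (mon (K + L)) M) \<noteq> 0"
    using assms by simp
  then obtain K where "K \<in> support u" "(\<Sum>L\<in>support v.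
      coeff u K * coeff v L * koszul K L * coeff (mon (K + L)) M) \<noteq> 0"
    by (rule sum.not_neutral_contains_not_neutral)
  then obtain L where "L \<in> support v"
      "coeff u K * coeff v L * koszul K L * coeff (mon (K + L)) M \<noteq> 0"
    by (meson sum.not_neutral_contains_not_neutral)
  then show ?thesis using that by (auto simp: coeff_mon split: if_splits)
qed

section \<open>Degrees and subalgebras\<close>

lemma mdeg_simps [simp]:
  "mdeg {#} = 0" "mdeg (add_mset x M) = gdeg x + mdeg M" "mdeg (M + N) = mdeg M + mdeg N"
  by (simp_all add: mdeg_def)

lemma homog_iff: "homog n u \<longleftrightarrow> (\<forall>M. coeff u M \<noteq> 0 \<longrightarrow> mdeg M = n)"
  by (auto simp: homog_def)

lemma Lam_iff: "u \<in> Lam G \<longleftrightarrow> (\<forall>M. coeff u M \<noteq> 0 \<longrightarrow> set_mset M \<subseteq> G)"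
  by (auto simp: Lam_def)

lemma homog_closed:
  "homog n 0" "homog n u \<Longrightarrow> homog n (- u)"
  "homog n u \<Longrightarrow> homog n v \<Longrightarrow> homog n (u + v)"
  "homog n u \<Longrightarrow> homog n v \<Longrightarrow> homog n (u - v)"
  "homog n u \<Longrightarrow> homog n (smult c u)" "homog n u \<Longrightarrow> homog n (bar u)"
  by (auto simp: homog_iff) force+

lemma homog_one: "homog 0 1"
  by (simp add: homog_iff coeff_mon flip: mon_empty)

lemma homog_gen: "homog (gdeg x) (gen x)"
  by (simp add: homog_iff gen_eq_mon coeff_mon)

lemma homog_genI: "gdeg x = n \<Longrightarrow> homog n (gen x)"
  using homog_gen by blast

lemma homog_sum: "(\<And>i. i \<in> A \<Longrightarrow> homog n (f i)) \<Longrightarrow> homog n (sum f A)"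
  by (induction A rule: infinite_finite_induct) (auto intro: homog_closed)

lemma homog_mult: "homog p u \<Longrightarrow> homog q v \<Longrightarrow> homog (p + q) (u * v)"
  by (auto simp: homog_iff elim!: support_mult)

lemma homog_mult_eq: "homog p u \<Longrightarrow> homog q v \<Longrightarrow> p + q = n \<Longrightarrow> homog n (u * v)"
  using homog_mult by blast

lemma homog_unique: "homog p u \<Longrightarrow> homog q u \<Longrightarrow> u \<noteq> 0 \<Longrightarrow> p = q"
  by (metis coeff_zero fgca_eqI homog_iff)

lemma bar_homog: "homog n u \<Longrightarrow> bar u = (-1) ^ (n + 1) * u"
proof -
  assume "homog n u"
  then have "bar u = smult ((-1) ^ (n + 1)) u"
    by (intro fgca_eqI) (auto simp: homog_iff)
  also have "smult ((-1) ^ (n + 1)) u = (-1) ^ (n + 1) * u"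
    by (cases "even n") (simp_all add: smult_simps)
  finally show ?thesis .
qed

lemma bar_even: "homog n u \<Longrightarrow> even n \<Longrightarrow> bar u = - u"
  by (simp add: bar_homog)

lemma bar_odd: "homog n u \<Longrightarrow> odd n \<Longrightarrow> bar u = u"
  by (simp add: bar_homog)

lemma bar_add [simp]: "bar (u + v) = bar u + bar v"
  by (rule fgca_eqI) (simp add: algebra_simps)

lemma bar_zero [simp]: "bar 0 = 0"
  by (rule fgca_eqI) simp

lemma bar_uminus [simp]: "bar (- u) = - bar u"
  by (rule fgca_eqI) (simp add: algebra_simps)

lemma bar_diff [simp]: "bar (u - v) = bar u - bar v"
  by (rule fgca_eqI) (simp add: algebra_simps)

lemma bar_smult [simp]: "bar (smult c u) = smult c (bar u)"
  by (rule fgca_eqI) (simp add: algebra_simps)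

lemma bar_sum: "bar (sum f A) = (\<Sum>i\<in>A. bar (f i))"
  by (induction A rule: infinite_finite_induct) auto

lemma bar_bar [simp]: "bar (bar u) = u"
  by (rule fgca_eqI) (simp flip: mult.assoc power_mult_distrib)

lemma bar_mon: "bar (mon M) = smult ((-1) ^ (mdeg M + 1)) (mon M)"
  by (rule fgca_eqI) (auto simp: coeff_mon)

text \<open>\<open>bar\<close> is minus the algebra automorphism that acts as
  \<open>(-1) ^ n\<close> in degree \<open>n\<close>; two minus signs against one leave a
  sign.\<close>

lemma bar_mult: "bar (u * v) = - (bar u * bar v)"
proof (induction u rule: fgca_induct)
  case (add u1 u2)
  then show ?case by (simp add: distrib_right)
next
  case M: (mon b M)
  show ?case
  proof (induction v rule: fgca_induct)
    case (add v1 v2)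
    then show ?case by (simp add: distrib_left)
  next
    case (mon b' N)
    show ?case by (rule fgca_eqI) (simp add: mult_mon bar_mon power_add)
  qed
qed

text \<open>Serves for homogeneous components (\<open>proj\<close>) and, in degree six, for
  splitting a cocycle of B into its part in A and the rest.\<close>

lift_definition restrict :: "('g::graded_gens multiset \<Rightarrow> bool) \<Rightarrow> 'g fgca \<Rightarrow> 'g fgca" is
  "\<lambda>P. Poly_Mapping.mapp (\<lambda>M c. if P M then c else 0)"
  by (auto simp: in_keys_iff lookup_mapp when_def split: if_splits)

lemma coeff_restrict [simp]: "coeff (restrict P u) M = (if P M then coeff u M else 0)"
  by transfer (simp add: lookup_mapp when_def in_keys_iff)

definition proj :: "nat \<Rightarrow> 'g::graded_gens fgca \<Rightarrow> 'g fgca" where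
  "proj n = restrict (\<lambda>M. mdeg M = n)"

lemma coeff_proj [simp]: "coeff (proj n u) M = (if mdeg M = n then coeff u M else 0)"
  by (simp add: proj_def)

lemma proj_simps:
  "proj n (u + v) = proj n u + proj n v" "proj n 0 = 0" "proj n (bar u) = bar (proj n u)"
  by (rule fgca_eqI; simp)+

lemma proj_sum: "proj n (sum f A) = (\<Sum>i\<in>A. proj n (f i))"
  by (induction A rule: infinite_finite_induct) (auto simp: proj_simps)

lemma homog_proj [simp]: "homog n (proj n u)"
  by (simp add: homog_iff)

lemma proj_homog: "homog n u \<Longrightarrow> proj n u = u"
  by (rule fgca_eqI) (auto simp: homog_iff)

lemma proj_homog_other: "homog p u \<Longrightarrow> p \<noteq> n \<Longrightarrow> proj n u = 0"
  by (rule fgca_eqI) (auto simp: homog_iff)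

text \<open>It suffices that one of the two factors already has the degree onto which it is projected.\<close>

lemma proj_mult:
  assumes "homog p u" "homog q v" "p = p' \<or> q = q'"
  shows "proj (p' + q') (u * v) = proj p' u * proj q' v"
proof (cases "p = p' \<and> q = q'")
  case True
  then show ?thesis using assms(1,2) by (simp add: proj_homog homog_mult)
next
  case False
  then have "p + q \<noteq> p' + q'" using assms(3) by auto
  then have "proj (p' + q') (u * v) = 0"
    using homog_mult[OF assms(1,2)] proj_homog_other by blast
  moreover have "proj p' u = 0 \<or> proj q' v = 0"
    using False assms proj_homog_other by blast
  ultimately show ?thesis by auto
qed

lemma Lam_add [intro, simp]: "u \<in> Lam G \<Longrightarrow> v \<in> Lam G \<Longrightarrow> u + v \<in> Lam G"
  unfolding Lam_iff coeff_add by (metis add_0)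

lemma Lam_closed [intro, simp]:
  "0 \<in> Lam G" "u \<in> Lam G \<Longrightarrow> - u \<in> Lam G"
  "u \<in> Lam G \<Longrightarrow> smult c u \<in> Lam G" "u \<in> Lam G \<Longrightarrow> bar u \<in> Lam G"
  "u \<in> Lam G \<Longrightarrow> restrict P u \<in> Lam G" "u \<in> Lam G \<Longrightarrow> proj n u \<in> Lam G"
  by (simp_all add: Lam_iff)

lemma Lam_diff [intro, simp]: "u \<in> Lam G \<Longrightarrow> v \<in> Lam G \<Longrightarrow> u - v \<in> Lam G"
  unfolding diff_conv_add_uminus by (intro Lam_add Lam_closed)

lemma Lam_mult [intro, simp]: "u \<in> Lam G \<Longrightarrow> v \<in> Lam G \<Longrightarrow> u * v \<in> Lam G"
  unfolding Lam_iff by (auto elim!: support_mult) blast+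

lemma Lam_gen [intro, simp]: "x \<in> G \<Longrightarrow> gen x \<in> Lam G"
  by (auto simp: Lam_iff gen_eq_mon coeff_mon)

lemma Lam_mon: "set_mset M \<subseteq> G \<Longrightarrow> mon M \<in> Lam G"
  by (auto simp: Lam_iff coeff_mon)

lemma Lam_sum [intro]: "(\<And>i. i \<in> A \<Longrightarrow> f i \<in> Lam G) \<Longrightarrow> sum f A \<in> Lam G"
  by (induction A rule: infinite_finite_induct) auto

lemma Lam_mono: "u \<in> Lam G \<Longrightarrow> G \<subseteq> H \<Longrightarrow> u \<in> Lam H"
  by (auto simp: Lam_iff)

section \<open>Normally ordered products\<close>

lemma monomial_add_mset [simp]:
  "monomial (add_mset x M) \<longleftrightarrow> monomial M \<and> (odd (gdeg x) \<longrightarrow> x \<notin># M)"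
proof
  assume *: "monomial (add_mset x M)"
  then have "monomial M"
    using monomial_add_right[of "{#x#}" M] by simp
  moreover have "x \<notin># M" if "odd (gdeg x)"
  proof -
    have "count (add_mset x M) x \<le> 1" using * that unfolding monomial_def by blast
    then show ?thesis by (simp add: not_in_iff)
  qed
  ultimately show "monomial M \<and> (odd (gdeg x) \<longrightarrow> x \<notin># M)" by blast
next
  assume *: "monomial M \<and> (odd (gdeg x) \<longrightarrow> x \<notin># M)"
  show "monomial (add_mset x M)"
    unfolding monomial_def
  proof (intro allI impI)
    fix y :: 'a assume "odd (gdeg y)"
    then show "count (add_mset x M) y \<le> 1"
      using * by (cases "y = x") (auto simp: monomial_def not_in_iff)
  qed
qed

text \<open>There is nothing to sort: \<open>x\<close> is even or already stands first. If
  \<open>x\<close> is odd and occurs in \<open>M\<close>, both sides are 0.\<close>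

lemma gen_mult_mon:
  assumes "even (gdeg x) \<or> (\<forall>y\<in>#M. x \<le> y)"
  shows "gen x * mon M = mon (add_mset x M)"
proof -
  have "inversions {#x#} M = {}"
    using assms by (auto simp: inversions_def)
  then show ?thesis
    unfolding gen_eq_mon mult_mon
    by (intro fgca_eqI) (auto simp: koszul_def coeff_mon)
qed

lemma gen_mult_gen:
  "even (gdeg x) \<or> x \<le> y \<Longrightarrow> gen x * gen y = mon {#x, y#}"
  using gen_mult_mon[of x "{#y#}"] by (simp add: gen_eq_mon)

lemma gen_even_commute: "even (gdeg x) \<Longrightarrow> gen x * u = u * gen x"
proof (induction u rule: fgca_induct)
  case (add u v)
  then show ?case by (simp add: distrib_left distrib_right)
next
  case (mon b M)
  have "inversions {#x#} M = {}" "inversions M {#x#} = {}"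
    using mon by (auto simp: inversions_def)
  then have "koszul {#x#} M = koszul M {#x#}" by (auto simp: koszul_def)
  then show ?case by (simp add: gen_eq_mon mult_mon)
qed

lemma gen_odd_anticommute:
  assumes "odd (gdeg x)" "odd (gdeg y)"
  shows "gen x * gen y = - (gen y * gen x)"
proof -
  consider "x = y" | "x < y" | "y < x" by fastforce
  then show ?thesis
  proof cases
    case 1
    then have "gen x * gen y = 0"
      using assms by (intro fgca_eqI) (simp add: gen_mult_gen coeff_mon)
    then show ?thesis using 1 by simp
  next
    case 2
    have "inversions {#x#} {#y#} = {}" "inversions {#y#} {#x#} = {(y, x)}"
      using 2 assms by (auto simp: inversions_def)
    then show ?thesis using 2 assms
      by (simp add: gen_eq_mon mult_mon koszul_def add_mset_commute smult_simps)
  next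
    case 3
    have "inversions {#y#} {#x#} = {}" "inversions {#x#} {#y#} = {(x, y)}"
      using 3 assms by (auto simp: inversions_def)
    then show ?thesis using 3 assms
      by (simp add: gen_eq_mon mult_mon koszul_def add_mset_commute smult_simps)
  qed
qed

section \<open>Cdgas without generators of degree at most one\<close>

text \<open>The bound on degrees leaves only scalars in degree 0 and nothing in degree 1, and it
  limits the number of factors of a monomial of given degree. Both A and B are instances.\<close>

locale cdga =
  fixes G :: "'g::graded_gens set" and d :: "'g fgca \<Rightarrow> 'g fgca"
  assumes differential: "differential_on (Lam G) d"
    and gdeg_ge_2: "x \<in> G \<Longrightarrow> 2 \<le> gdeg x"
begin

abbreviation "C \<equiv> Lam G"

definition exact :: "'g fgca \<Rightarrow> bool" where
  "exact z \<longleftrightarrow> z \<in> coboundaries C d"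

lemma d_closed [simp, intro]: "u \<in> C \<Longrightarrow> d u \<in> C"
  and d_add [simp]: "u \<in> C \<Longrightarrow> v \<in> C \<Longrightarrow> d (u + v) = d u + d v"
  and d_smult [simp]: "u \<in> C \<Longrightarrow> d (smult c u) = smult c (d u)"
  and d_homog: "u \<in> C \<Longrightarrow> homog n u \<Longrightarrow> homog (n + 1) (d u)"
  and d_mult: "u \<in> C \<Longrightarrow> v \<in> C \<Longrightarrow> homog n u \<Longrightarrow> d (u * v) = d u * v + (-1) ^ n * u * d v"
  and d_d [simp]: "u \<in> C \<Longrightarrow> d (d u) = 0"
  using differential unfolding differential_on_def by blast+

lemma d_zero [simp]: "d 0 = 0"
  using d_smult[of 0 0] by (simp add: smult_simps)

lemma d_uminus [simp]: "u \<in> C \<Longrightarrow> d (- u) = - d u"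
  using d_smult[of u "-1"] by (simp add: smult_simps)

lemma d_diff [simp]: "u \<in> C \<Longrightarrow> v \<in> C \<Longrightarrow> d (u - v) = d u - d v"
  using d_add[of u "- v"] by simp

lemma d_sum: "(\<And>i. i \<in> A \<Longrightarrow> f i \<in> C) \<Longrightarrow> d (sum f A) = (\<Sum>i\<in>A. d (f i))"
  by (induction A rule: infinite_finite_induct) (simp_all add: Lam_sum)

lemma d_mult_bar: "u \<in> C \<Longrightarrow> v \<in> C \<Longrightarrow> homog n u \<Longrightarrow> d (u * v) = d u * v - bar u * d v"
  by (simp add: d_mult bar_homog)

lemma d_bar: "u \<in> C \<Longrightarrow> homog n u \<Longrightarrow> d (bar u) = - bar (d u)"
  using d_homog[of u n] by (cases "even n") (simp_all add: bar_homog)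

text \<open>\<open>differential_on\<close> speaks about degrees of homogeneous elements only, so
  \<open>u\<close> is expanded into monomials. This makes it possible to choose homogeneous
  primitives and to cut the equations of a defining system down to one degree.\<close>

lemma d_proj: "u \<in> C \<Longrightarrow> d (proj n u) = proj (n + 1) (d u)"
proof -
  assume u: "u \<in> C"
  have mC: "mon M \<in> C" if "M \<in> support u" for M
    using u that by (intro Lam_mon) (auto simp: Lam_iff)
  have homog_mon: "homog (mdeg M) (mon M)" for M :: "'g multiset"
    by (simp add: homog_iff coeff_mon)
  have "d (proj n (smult c (mon M))) = proj (n + 1) (d (smult c (mon M)))"
    if "M \<in> support u" for M c
  proof (cases "mdeg M = n")
    case True
    then show ?thesis
      using homog_mon[of M] mC[OF that] d_homog[of "smult c (mon M)" n]
      by (simp add: proj_homog homog_closed)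
  next
    case False
    have h: "homog (mdeg M) (smult c (mon M))" by (simp add: homog_closed homog_mon)
    have "proj n (smult c (mon M)) = 0"
      using False h by (rule proj_homog_other[rotated])
    moreover have "proj (n + 1) (d (smult c (mon M))) = 0"
      using False mC[OF that] h by (intro proj_homog_other[of "mdeg M + 1"] d_homog) auto
    ultimately show ?thesis by simp
  qed
  then have "d (proj n (\<Sum>M\<in>support u. smult (coeff u M) (mon M)))
      = proj (n + 1) (d (\<Sum>M\<in>support u. smult (coeff u M) (mon M)))"
    unfolding proj_sum using mC by (subst (1 2) d_sum) (auto simp: proj_sum simp del: d_smult)
  then show ?thesis by (simp flip: fgca_expand)
qed

lemma exactI: "u \<in> C \<Longrightarrow> z = d u \<Longrightarrow> exact z"
  by (auto simp: exact_def coboundaries_def)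

lemma exactE: "exact z \<Longrightarrow> (\<And>u. u \<in> C \<Longrightarrow> z = d u \<Longrightarrow> P) \<Longrightarrow> P"
  by (auto simp: exact_def coboundaries_def)

lemma exact_homogE:
  assumes "exact z" "homog (n + 1) z"
  obtains u where "u \<in> C" "homog n u" "d u = z"
proof -
  obtain u where "u \<in> C" "z = d u" using assms(1) by (rule exactE)
  then show ?thesis
    using assms(2) by (intro that[of "proj n u"]) (auto simp: d_proj proj_homog)
qed

lemma exact_closed:
  "exact 0" "exact z \<Longrightarrow> exact (- z)" "exact z \<Longrightarrow> exact (smult c z)"
  "exact z \<Longrightarrow> exact w \<Longrightarrow> exact (z + w)" "exact z \<Longrightarrow> exact w \<Longrightarrow> exact (z - w)"
proof -
  show "exact 0" by (rule exactI[of 0]) simp_all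
  show "exact z \<Longrightarrow> exact (- z)"
    by (elim exactE) (metis Lam_closed(2) d_uminus exactI)
  show "exact z \<Longrightarrow> exact (smult c z)"
    by (elim exactE) (metis Lam_closed(3) d_smult exactI)
  show "exact z \<Longrightarrow> exact w \<Longrightarrow> exact (z + w)"
    by (elim exactE) (metis Lam_add d_add exactI)
  show "exact z \<Longrightarrow> exact w \<Longrightarrow> exact (z - w)"
    by (elim exactE) (metis Lam_diff d_diff exactI)
qed

lemma cohom_class_exact: "exact z \<Longrightarrow> cohom_class C d z = cohom_class C d 0"
proof -
  assume z: "exact z"
  have "z + b \<in> coboundaries C d" "b - z \<in> coboundaries C d" if "b \<in> coboundaries C d" for b
    using exact_closed(4)[OF z] exact_closed(5)[OF _ z] that unfolding exact_def by blast+
  then show ?thesis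
    unfolding cohom_class_def by (auto intro: exI[of _ "_ - z"])
qed

lemma homog_0_eq: "u \<in> C \<Longrightarrow> homog 0 u \<Longrightarrow> u = smult (coeff u {#}) 1"
proof (rule fgca_eqI)
  fix M assume u: "u \<in> C" "homog 0 u"
  have "M = {#}" if "coeff u M \<noteq> 0"
  proof (rule ccontr)
    assume "M \<noteq> {#}"
    then obtain x M' where M: "M = add_mset x M'" by (meson multiset_cases)
    then have "x \<in> G" "mdeg M = 0" using u that by (auto simp: Lam_iff homog_iff)
    then show False using gdeg_ge_2[of x] M by simp
  qed
  then show "coeff u M = coeff (smult (coeff u {#}) 1) M"
    by (auto simp: coeff_mon simp flip: mon_empty)
qed

lemma homog_1_eq: "u \<in> C \<Longrightarrow> homog 1 u \<Longrightarrow> u = 0"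
proof (rule fgca_eqI)
  fix M assume u: "u \<in> C" "homog 1 u"
  have False if nz: "coeff u M \<noteq> 0"
  proof (cases M)
    case empty
    then show False using u nz by (force simp: homog_iff)
  next
    case (add x M')
    then have "x \<in> G" "mdeg M = 1" using u nz by (auto simp: Lam_iff homog_iff)
    then show False using gdeg_ge_2[of x] add by simp
  qed
  then show "coeff u M = coeff 0 M" by auto
qed

section \<open>Massey products\<close>

lemma massey_vanishesI:
  "defining_system C d m x a \<Longrightarrow> exact (\<Sum>l\<in>{0<..<m}. bar (a 0 l) * a l m) \<Longrightarrow> massey_vanishes C d m x"
  unfolding massey_vanishes_def massey_product_def using cohom_class_exact by blast

lemma defining_systemD:
  assumes "defining_system C d m x a"
  shows "i < j \<Longrightarrow> j \<le> m \<Longrightarrow> (i, j) \<noteq> (0, m) \<Longrightarrow> a i j \<in> C"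
    and "i < j \<Longrightarrow> j \<le> m \<Longrightarrow> (i, j) \<noteq> (0, m) \<Longrightarrow> \<exists>n. homog n (a i j)"
    and "i < m \<Longrightarrow> d (a i (Suc i)) = 0"
    and "i < m \<Longrightarrow> cohom_class C d (a i (Suc i)) = x (Suc i)"
    and "i + 2 \<le> j \<Longrightarrow> j \<le> m \<Longrightarrow> (i, j) \<noteq> (0, m) \<Longrightarrow> d (a i j) = (\<Sum>l\<in>{i<..<j}. bar (a i l) * a l j)"
  using assms unfolding defining_system_def
  by (blast, blast, force, force, blast)

text \<open>If the class with representative \<open>a i (i + 1)\<close> is zero, all entries of the defining system
  which involve this class can be replaced by zero.\<close>

lemma massey_vanishes_zero_class:
  assumes a: "defining_system C d m x a" and i: "i < m" and ex: "exact (a i (Suc i))"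
  shows "massey_vanishes C d m x"
proof -
  define a' where "a' k j = (if k \<le> i \<and> i < j then 0 else a k j)" for k j
  have "defining_system C d m x a'"
    unfolding defining_system_def
  proof (intro conjI allI impI ballI)
    fix k j assume "k < j \<and> j \<le> m \<and> (k, j) \<noteq> (0, m)"
    then show "a' k j \<in> C" "\<exists>n. homog n (a' k j)"
      using defining_systemD(1,2)[OF a] by (auto simp: a'_def homog_closed)
  next
    fix k assume "k \<in> {1..m}"
    then obtain k' where k': "k = Suc k'" "k' < m" by (cases k) auto
    \<comment> \<open>Only the entry with \<open>k' = i\<close> has changed, and there the class of
      0 is the old class by \<open>ex\<close>.\<close>
    then show "d (a' (k - 1) k) = 0" "cohom_class C d (a' (k - 1) k) = x k"
      using defining_systemD(3,4)[OF a, of k'] cohom_class_exact[OF ex]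
      by (auto simp: a'_def not_less less_Suc_eq_le dest: le_antisym)
  next
    fix k j assume kj: "k + 2 \<le> j \<and> j \<le> m \<and> (k, j) \<noteq> (0, m)"
    show "d (a' k j) = (\<Sum>l\<in>{k<..<j}. bar (a' k l) * a' l j)"
    proof (cases "k \<le> i \<and> i < j")
      case True
      \<comment> \<open>If an interval containing the step from \<open>i\<close> to
        \<open>i + 1\<close> is cut at \<open>l\<close>, one of the two halves still contains that
        step.\<close>
      then have "bar (a' k l) * a' l j = 0" for l by (cases "l \<le> i") (auto simp: a'_def)
      then show ?thesis using True by (simp add: a'_def)
    next
      case False
      have "d (a' k j) = (\<Sum>l\<in>{k<..<j}. bar (a k l) * a l j)"
        using False defining_systemD(5)[OF a] kj by (auto simp: a'_def)
      also have "\<dots> = (\<Sum>l\<in>{k<..<j}. bar (a' k l) * a' l j)"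
        using False by (intro sum.cong) (auto simp: a'_def)
      finally show ?thesis .
    qed
  qed
  moreover have "bar (a' 0 l) * a' l m = 0" for l
    using i by (cases "l \<le> i") (auto simp: a'_def)
  then have "exact (\<Sum>l\<in>{0<..<m}. bar (a' 0 l) * a' l m)"
    by (simp only: sum.neutral_const exact_closed(1))
  ultimately show ?thesis
    by (rule massey_vanishesI)
qed

text \<open>A class of degree zero is a multiple of the unit; if it is not zero, then its neighbour,
  whose product with it vanishes, is zero.\<close>

lemma exact_neighbour:
  assumes a: "defining_system C d m x a" and m: "m \<ge> 3" and i: "i < m"
    and h: "homog 0 (a i (Suc i))"
  obtains j where "j < m" "exact (a j (Suc j))"
proof (cases "a i (Suc i) = 0")
  case True
  then show ?thesis using that[of i] i by (simp add: exact_closed)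
next
  case False
  define c where "c = coeff (a i (Suc i)) {#}"
  have "(i, Suc i) \<noteq> (0, m)" using m by auto
  then have "a i (Suc i) \<in> C" using defining_systemD(1)[OF a, of i "Suc i"] i by simp
  then have ac: "a i (Suc i) = smult c 1"
    unfolding c_def using h by (rule homog_0_eq)
  with False have c: "c \<noteq> 0" by (auto simp: smult_simps)
  have bar_c: "bar (smult c 1) = - smult c (1 :: 'g fgca)"
    by (simp add: bar_even[OF homog_one] smult_simps)
  have cancel: "u = smult (1 / c) (smult c u)" for u :: "'g fgca"
    using c by (simp add: smult_simps)
  show ?thesis
  \<comment> \<open>The right neighbour is taken unless \<open>i\<close> is the last index. Since
    \<open>m \<ge> 3\<close>, the pair of length two is not \<open>(0, m)\<close>, so the system
    contains a primitive of the product with the neighbour.\<close>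
  proof (cases "Suc i < m")
    case True
    have "(i, i + 2) \<noteq> (0, m)" using m by auto
    then have C: "a i (i + 2) \<in> C"
      and "d (a i (i + 2)) = (\<Sum>l\<in>{i<..<i + 2}. bar (a i l) * a l (i + 2))"
      using defining_systemD(1,5)[OF a, of i "i + 2"] True by auto
    moreover have "{i<..<i + 2} = {Suc i}" by auto
    ultimately have "d (a i (i + 2)) = - smult c (a (Suc i) (Suc (Suc i)))"
      by (simp add: ac bar_c del: bar_smult)
    then have "a (Suc i) (Suc (Suc i)) = smult (1 / c) (- d (a i (i + 2)))"
      using cancel by simp
    then have "exact (a (Suc i) (Suc (Suc i)))"
      using C by (auto intro!: exact_closed exactI)
    then show ?thesis using that True by blast
  next
    case False
    define k where "k = m - 2"
    with False i m have k: "i = Suc k" "m = Suc (Suc k)" "k > 0" by auto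
    have C: "a k (k + 2) \<in> C"
      and "d (a k (k + 2)) = (\<Sum>l\<in>{k<..<k + 2}. bar (a k l) * a l (k + 2))"
      using defining_systemD(1,5)[OF a, of k "k + 2"] k by auto
    moreover have "{k<..<k + 2} = {Suc k}" by auto
    ultimately have "d (a k (k + 2)) = smult c (bar (a k (Suc k)))"
      using ac k by simp
    then have "bar (a k (Suc k)) = smult (1 / c) (d (a k (k + 2)))"
      using cancel by simp
    then have e: "exact (bar (a k (Suc k)))"
      using C by (auto intro!: exact_closed exactI)
    \<comment> \<open>The sign hidden in \<open>bar\<close> depends on the degree, but it does not
      affect exactness.\<close>
    obtain n where "homog n (a k (Suc k))"
      using defining_systemD(2)[OF a, of k "Suc k"] k by auto
    then have "exact (a k (Suc k))"
      using exact_closed(2)[OF e] e by (cases "even n") (simp_all add: bar_homog)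
    then show ?thesis using that[of k] k by simp
  qed
qed

text \<open>Each triple \<open>i < k < l < j\<close> contributes twice to the differential, once
  from either factor, with opposite signs. Formulated for a subinterval in order to cover
  obstructions met while a system is still being built.\<close>

lemma massey_sum_closed:
  fixes a :: "nat \<Rightarrow> nat \<Rightarrow> 'g fgca"
  assumes C: "\<And>k l. i \<le> k \<Longrightarrow> k < l \<Longrightarrow> l \<le> j \<Longrightarrow> (k, l) \<noteq> (i, j) \<Longrightarrow> a k l \<in> C \<and> (\<exists>n. homog n (a k l))"
    and eq: "\<And>k l. i \<le> k \<Longrightarrow> k < l \<Longrightarrow> l \<le> j \<Longrightarrow> (k, l) \<noteq> (i, j) \<Longrightarrow>
      d (a k l) = (\<Sum>r\<in>{k<..<l}. bar (a k r) * a r l)"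
  shows "d (\<Sum>l\<in>{i<..<j}. bar (a i l) * a l j) = 0"
proof -
  have "d (bar (a i l) * a l j) = (\<Sum>k\<in>{i<..<l}. a i k * bar (a k l) * a l j)
      - (\<Sum>k\<in>{l<..<j}. a i l * bar (a l k) * a k j)" if l: "l \<in> {i<..<j}" for l
  proof -
    obtain n where n: "homog n (a i l)" using C[of i l] l by auto
    have il: "a i l \<in> C" and lj: "a l j \<in> C" using C[of i l] C[of l j] l by auto
    have "d (bar (a i l) * a l j) = d (bar (a i l)) * a l j - bar (bar (a i l)) * d (a l j)"
      using il lj n by (intro d_mult_bar) (auto intro: homog_closed)
    also have "\<dots> = - bar (d (a i l)) * a l j - a i l * d (a l j)"
      using d_bar[OF il n] by simp
    also have "- bar (d (a i l)) = (\<Sum>k\<in>{i<..<l}. a i k * bar (a k l))"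
      using eq[of i l] l by (simp add: bar_sum bar_mult sum_negf)
    also have "d (a l j) = (\<Sum>k\<in>{l<..<j}. bar (a l k) * a k j)"
      using eq[of l j] l by simp
    finally show ?thesis by (simp add: sum_distrib_left sum_distrib_right mult.assoc)
  qed
  moreover have "bar (a i l) * a l j \<in> C" if "l \<in> {i<..<j}" for l
    using C[of i l] C[of l j] that by auto
  ultimately have "d (\<Sum>l\<in>{i<..<j}. bar (a i l) * a l j)
      = (\<Sum>l\<in>{i<..<j}. \<Sum>k\<in>{i<..<l}. a i k * bar (a k l) * a l j)
      - (\<Sum>l\<in>{i<..<j}. \<Sum>k\<in>{l<..<j}. a i l * bar (a l k) * a k j)"
    by (subst d_sum) (simp_all add: sum_subtractf)
  also have "(\<Sum>l\<in>{i<..<j}. \<Sum>k\<in>{i<..<l}. a i k * bar (a k l) * a l j)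
      = (\<Sum>k\<in>{i<..<j}. \<Sum>l\<in>{k<..<j}. a i k * bar (a k l) * a l j)"
    by (subst (1 2) sum.Sigma, simp, simp, simp, simp)
      (rule sum.reindex_bij_witness[where i = prod.swap and j = prod.swap]; auto)
  finally show ?thesis by simp
qed

end

section \<open>Degrees of the entries of a defining system\<close>

text \<open>With \<open>n k\<close> the degree of the \<open>k\<close>-th class, the entry \<open>a i j\<close> of a defining system is expected
  in degree \<open>excess n i j + 1\<close> and its obstruction in degree \<open>excess n i j + 2\<close>.\<close>

definition excess :: "(nat \<Rightarrow> nat) \<Rightarrow> nat \<Rightarrow> nat \<Rightarrow> nat" where
  "excess n i j = (\<Sum>k\<in>{i<..j}. n k - 1)"

lemma excess_Suc [simp]: "excess n i (Suc i) = n (Suc i) - 1"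
proof -
  have "{i<..Suc i} = {Suc i}" by auto
  then show ?thesis by (simp add: excess_def)
qed

lemma excess_split: "i \<le> l \<Longrightarrow> l \<le> j \<Longrightarrow> excess n i j = excess n i l + excess n l j"
proof -
  assume "i \<le> l" "l \<le> j"
  then have "{i<..j} = {i<..l} \<union> {l<..j}" by auto
  then show ?thesis by (simp add: excess_def sum.union_disjoint Int_def)
qed

lemma excess_ge:
  assumes "\<And>k. k \<in> {i<..j} \<Longrightarrow> 2 \<le> n k"
  shows "j - i \<le> excess n i j"
proof -
  have "j - i = (\<Sum>k\<in>{i<..j}. 1)" by simp
  also have "\<dots> \<le> excess n i j"
    unfolding excess_def using assms by (intro sum_mono) fastforce
  finally show ?thesis .
qed

context cdga
begin

text \<open>The entries of a defining system are homogeneous, but when they are closed they may have an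
  unexpected degree. This can be corrected: entries of excess at most four are replaced by their
  components of the expected degree, and the other ones are constructed anew because their
  obstructions have degree at least seven.\<close>

lemma defining_system_expected_degrees:
  assumes a: "defining_system C d m x a" and m: "m \<ge> 3"
    and hom: "\<And>i. i < m \<Longrightarrow> homog (n (Suc i)) (a i (Suc i))"
    and n: "\<And>k. k \<in> {1..m} \<Longrightarrow> 2 \<le> n k"
    and nz: "\<And>i. i < m \<Longrightarrow> a i (Suc i) \<noteq> 0"
    and no_zero_div: "\<And>u v. u \<in> C \<Longrightarrow> v \<in> C \<Longrightarrow> homog 2 u \<Longrightarrow> homog 2 v \<Longrightarrow> u * v = 0 \<Longrightarrow> u = 0 \<or> v = 0"
    and H: "\<And>k z. 7 \<le> k \<Longrightarrow> z \<in> C \<Longrightarrow> homog k z \<Longrightarrow> d z = 0 \<Longrightarrow> exact z"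
  obtains a' where "defining_system C d m x a'"
    "\<And>i j. i < j \<Longrightarrow> j \<le> m \<Longrightarrow> (i, j) \<noteq> (0, m) \<Longrightarrow> homog (excess n i j + 1) (a' i j)"
proof -
  let ?E = "excess n"
  \<comment> \<open>\<open>s\<close> bounds the length of the entries already treated. The clause
    with \<open>proj\<close> remembers which entries are components of the old ones: for these the
    old equation yields the new one by projection.\<close>
  define good where "good a' s \<longleftrightarrow> (\<forall>i j. i < j \<and> j \<le> m \<and> j \<le> i + s \<and> (i, j) \<noteq> (0, m) \<longrightarrow>
      a' i j \<in> C \<and> homog (?E i j + 1) (a' i j) \<and>
      (?E i j \<le> 4 \<longrightarrow> a' i j = proj (?E i j + 1) (a i j)) \<and>
      (j = Suc i \<longrightarrow> a' i j = a i j) \<and>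
      (i + 2 \<le> j \<longrightarrow> d (a' i j) = (\<Sum>l\<in>{i<..<j}. bar (a' i l) * a' l j)))" for a' s
  have E_ge: "j - i \<le> ?E i j" if "j \<le> m" for i j
    using that n by (intro excess_ge) auto
  have E_Suc: "?E i (Suc i) + 1 = n (Suc i)" if "i < m" for i
    using n[of "Suc i"] that by simp
  have single: "homog (?E i j + 1) (a i j)" if "j = Suc i" "i < m" for i j
    using hom[of i] E_Suc[of i] that by simp
  \<comment> \<open>This is the hypothesis of \<open>proj_mult\<close>. If neither factor has length
    one, excess at most four forces both to have length two and excess two. Then
    \<open>d (a i l)\<close> is, up to sign, a nonzero product of two elements of degree two, so
    \<open>a i l\<close> has degree three as expected.\<close>
  have degrees: "\<exists>p q. homog p (a i l) \<and> homog q (a l j) \<and> (p = ?E i l + 1 \<or> q = ?E l j + 1)"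
    if range: "i < l" "l < j" "j \<le> m" "?E i j \<le> 4" for i l j
  proof -
    have ne: "(i, l) \<noteq> (0, m)" "(l, j) \<noteq> (0, m)" using range by auto
    have "l \<le> m" using range by simp
    then obtain p where p: "homog p (a i l)"
      using defining_systemD(2)[OF a range(1) _ ne(1)] by blast
    obtain q where q: "homog q (a l j)"
      using defining_systemD(2)[OF a range(2,3) ne(2)] by blast
    consider "l = Suc i" | "j = Suc l" | "i + 2 \<le> l" "l + 2 \<le> j" using range by linarith
    then show ?thesis
    proof cases
      case 1
      then show ?thesis using single[of l i] q range by auto
    next
      case 2
      then show ?thesis using single[of j l] p range by auto
    next
      case 3
      have "?E i j = ?E i l + ?E l j" using range by (intro excess_split) auto
      moreover have "l - i \<le> ?E i l" "j - l \<le> ?E l j" using E_ge range by auto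
      ultimately have l: "l = Suc (Suc i)" and E2: "?E i l = 2" using 3 range by linarith+
      have "?E i l = ?E i (Suc i) + ?E (Suc i) l" using l by (intro excess_split) auto
      then have n2: "n (Suc i) = 2" "n (Suc (Suc i)) = 2"
        using l E2 n[of "Suc i"] n[of "Suc (Suc i)"] range by auto
      have C: "a i (Suc i) \<in> C" "a (Suc i) l \<in> C"
        using defining_systemD(1)[OF a] range l m by auto
      have h2: "homog 2 (a i (Suc i))" "homog 2 (a (Suc i) l)"
        using hom[of i] hom[of "Suc i"] n2 l range by auto
      have "{i<..<l} = {Suc i}" using l by auto
      then have "d (a i l) = bar (a i (Suc i)) * a (Suc i) l"
        using defining_systemD(5)[OF a, of i l] l ne range by simp
      also have "\<dots> = - (a i (Suc i) * a (Suc i) l)" using h2 by (simp add: bar_even)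
      finally have da: "d (a i l) = - (a i (Suc i) * a (Suc i) l)" .
      have "d (a i l) \<noteq> 0"
        unfolding da using no_zero_div[OF C h2] nz[of i] nz[of "Suc i"] l range by auto
      moreover have "homog 4 (d (a i l))"
        unfolding da using h2 by (intro homog_closed(2) homog_mult_eq[of 2 _ 2]) auto
      moreover have "homog (p + 1) (d (a i l))"
        using p defining_systemD(1)[OF a, of i l] ne range by (intro d_homog) auto
      ultimately have "p + 1 = 4" using homog_unique by blast
      then show ?thesis using p q E2 by auto
    qed
  qed
  have "\<exists>a'. good a' (Suc s)" for s
  proof (induction s)
    case 0
    have "good a (Suc 0)"
      unfolding good_def
    proof (intro allI impI)
      fix i j assume ij: "i < j \<and> j \<le> m \<and> j \<le> i + Suc 0 \<and> (i, j) \<noteq> (0, m)"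
      then have "j = Suc i" by simp
      then show "a i j \<in> C \<and> homog (?E i j + 1) (a i j) \<and>
        (?E i j \<le> 4 \<longrightarrow> a i j = proj (?E i j + 1) (a i j)) \<and>
        (j = Suc i \<longrightarrow> a i j = a i j) \<and>
        (i + 2 \<le> j \<longrightarrow> d (a i j) = (\<Sum>l\<in>{i<..<j}. bar (a i l) * a l j))"
        using single[of j i] proj_homog[OF single[of j i]] defining_systemD(1)[OF a, of i j] ij
        by auto
    qed
    then show ?case by blast
  next
    case (Suc s)
    then obtain a' where a': "good a' (Suc s)" ..
    let ?z = "\<lambda>i j. \<Sum>l\<in>{i<..<j}. bar (a' i l) * a' l j"
    \<comment> \<open>The threshold four comes from \<open>H\<close>: the obstruction has degree
      excess plus two, which is at least seven beyond it.\<close>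
    define a'' where "a'' i j = (if j = i + Suc (Suc s) then
        if ?E i j \<le> 4 then proj (?E i j + 1) (a i j)
        else SOME b. b \<in> C \<and> homog (?E i j + 1) b \<and> d b = ?z i j
      else a' i j)" for i j
    have "good a'' (Suc (Suc s))"
      unfolding good_def
    proof (intro allI impI, elim conjE)
      fix i j assume ij: "i < j" "j \<le> m" "j \<le> i + Suc (Suc s)" "(i, j) \<noteq> (0, m)"
      have sub: "a' k l \<in> C" "homog (?E k l + 1) (a' k l)"
          "?E k l \<le> 4 \<Longrightarrow> a' k l = proj (?E k l + 1) (a k l)"
          "k + 2 \<le> l \<Longrightarrow> d (a' k l) = ?z k l" "l = Suc k \<Longrightarrow> a' k l = a k l"
        if "i \<le> k" "k < l" "l \<le> j" "(k, l) \<noteq> (i, j)" for k l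
      proof -
        have "k < l \<and> l \<le> m \<and> l \<le> k + Suc s \<and> (k, l) \<noteq> (0, m)" using ij that by auto
        then show "a' k l \<in> C" "homog (?E k l + 1) (a' k l)"
          "?E k l \<le> 4 \<Longrightarrow> a' k l = proj (?E k l + 1) (a k l)"
          "k + 2 \<le> l \<Longrightarrow> d (a' k l) = ?z k l" "l = Suc k \<Longrightarrow> a' k l = a k l"
          using a' unfolding good_def by blast+
      qed
      have same: "(\<Sum>l\<in>{i<..<j}. bar (a'' i l) * a'' l j) = ?z i j"
        using ij by (intro sum.cong) (auto simp: a''_def)
      show "a'' i j \<in> C \<and> homog (?E i j + 1) (a'' i j) \<and>
        (?E i j \<le> 4 \<longrightarrow> a'' i j = proj (?E i j + 1) (a i j)) \<and>
        (j = Suc i \<longrightarrow> a'' i j = a i j) \<and>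
        (i + 2 \<le> j \<longrightarrow> d (a'' i j) = (\<Sum>l\<in>{i<..<j}. bar (a'' i l) * a'' l j))"
      proof (cases "j = i + Suc (Suc s)")
        case False
        then have "i < j \<and> j \<le> m \<and> j \<le> i + Suc s \<and> (i, j) \<noteq> (0, m)" using ij by auto
        then show ?thesis using a' False unfolding same unfolding good_def a''_def by simp
      next
        case top: True
        have aC: "a i j \<in> C" using defining_systemD(1)[OF a] ij by auto
        show ?thesis
        proof (cases "?E i j \<le> 4")
          case True
          have "d (proj (?E i j + 1) (a i j)) = proj (?E i j + 2) (d (a i j))"
            using aC by (simp add: d_proj)
          also have "d (a i j) = (\<Sum>l\<in>{i<..<j}. bar (a i l) * a l j)"
            using defining_systemD(5)[OF a] ij top by simp
          also have "proj (?E i j + 2) \<dots> = ?z i j"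
            unfolding proj_sum
          proof (intro sum.cong refl)
            fix l assume l: "l \<in> {i<..<j}"
            then have split: "?E i j = ?E i l + ?E l j" by (intro excess_split) auto
            obtain p q where pq: "homog p (a i l)" "homog q (a l j)"
                "p = ?E i l + 1 \<or> q = ?E l j + 1"
              using degrees[of i l j] l True ij by auto
            have "proj (?E i j + 2) (bar (a i l) * a l j)
                = proj ((?E i l + 1) + (?E l j + 1)) (bar (a i l) * a l j)"
              using split by simp
            also have "\<dots> = proj (?E i l + 1) (bar (a i l)) * proj (?E l j + 1) (a l j)"
              using pq by (intro proj_mult) (auto intro: homog_closed)
            also have "\<dots> = bar (a' i l) * a' l j"
              using sub(3)[of i l] sub(3)[of l j] l True split by (simp add: proj_simps)
            finally show "proj (?E i j + 2) (bar (a i l) * a l j) = bar (a' i l) * a' l j" .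
          qed
          finally show ?thesis using aC top True same by (simp add: a''_def)
        next
          case False
          have "?z i j \<in> C" using sub(1) by (intro Lam_sum Lam_mult Lam_closed) auto
          moreover have hz: "homog (?E i j + 2) (?z i j)"
          proof (rule homog_sum)
            fix l assume l: "l \<in> {i<..<j}"
            then have split: "?E i j = ?E i l + ?E l j" by (intro excess_split) auto
            show "homog (?E i j + 2) (bar (a' i l) * a' l j)"
              using sub(2)[of i l] sub(2)[of l j] l split
              by (intro homog_mult_eq[of "?E i l + 1" _ "?E l j + 1"]) (auto intro: homog_closed)
          qed
          moreover have "d (?z i j) = 0"
          proof (rule massey_sum_closed)
            fix k l assume kl: "i \<le> k" "k < l" "l \<le> j" "(k, l) \<noteq> (i, j)"
            then show "a' k l \<in> C \<and> (\<exists>n. homog n (a' k l))" using sub(1,2)[OF kl] by blast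
            show "d (a' k l) = ?z k l"
            proof (cases "l = Suc k")
              case True
              then have "a' k l = a k l" using sub(5)[OF kl] by simp
              moreover have "{k<..<l} = {}" using True by auto
              ultimately show ?thesis using defining_systemD(3)[OF a, of k] True kl ij by simp
            next
              case False
              then show ?thesis using sub(4)[OF kl] kl by simp
            qed
          qed
          ultimately have "exact (?z i j)" using False by (intro H[of "?E i j + 2"]) auto
          then obtain b where "b \<in> C" "homog (?E i j + 1) b" "d b = ?z i j"
            using hz by (elim exact_homogE[of _ "?E i j + 1"]) auto
          then have ex: "\<exists>b. b \<in> C \<and> homog (?E i j + 1) b \<and> d b = ?z i j" by blast
          have "a'' i j = (SOME b. b \<in> C \<and> homog (?E i j + 1) b \<and> d b = ?z i j)"
            using False top by (simp add: a''_def)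
          with someI_ex[OF ex]
          have "a'' i j \<in> C \<and> homog (?E i j + 1) (a'' i j) \<and> d (a'' i j) = ?z i j"
            by (simp only:)
          then show ?thesis using False top same by simp
        qed
      qed
    qed
    then show ?case by blast
  qed
  from this[of m] obtain a' where a': "good a' (Suc m)" ..
  have ok: "a' i j \<in> C" "homog (?E i j + 1) (a' i j)" "j = Suc i \<Longrightarrow> a' i j = a i j"
      "i + 2 \<le> j \<Longrightarrow> d (a' i j) = (\<Sum>l\<in>{i<..<j}. bar (a' i l) * a' l j)"
    if "i < j" "j \<le> m" "(i, j) \<noteq> (0, m)" for i j
  proof -
    have "i < j \<and> j \<le> m \<and> j \<le> i + Suc m \<and> (i, j) \<noteq> (0, m)" using that by auto
    then show "a' i j \<in> C" "homog (?E i j + 1) (a' i j)" "j = Suc i \<Longrightarrow> a' i j = a i j"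
      "i + 2 \<le> j \<Longrightarrow> d (a' i j) = (\<Sum>l\<in>{i<..<j}. bar (a' i l) * a' l j)"
      using a' unfolding good_def by blast+
  qed
  have "defining_system C d m x a'"
    unfolding defining_system_def
  proof (intro conjI allI impI ballI)
    fix i assume "i \<in> {1..m}"
    then obtain k where k: "i = Suc k" "k < m" by (cases i) auto
    then have "a' k i = a k i" using m by (intro ok) auto
    then show "d (a' (i - 1) i) = 0" "cohom_class C d (a' (i - 1) i) = x i"
      using defining_systemD(3,4)[OF a, of k] k by simp_all
  next
    fix i j assume "i < j \<and> j \<le> m \<and> (i, j) \<noteq> (0, m)"
    then show "a' i j \<in> C" "\<exists>k. homog k (a' i j)" using ok(1,2)[of i j] by blast+
  next
    fix i j assume "i + 2 \<le> j \<and> j \<le> m \<and> (i, j) \<noteq> (0, m)"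
    then show "d (a' i j) = (\<Sum>l\<in>{i<..<j}. bar (a' i l) * a' l j)"
      by (intro ok(4)) auto
  qed
  then show ?thesis using that ok(2) by blast
qed

lemma massey_sum_closed_of_defining_system:
  assumes a: "defining_system C d m x a"
  shows "d (\<Sum>l\<in>{0<..<m}. bar (a 0 l) * a l m) = 0"
proof (rule massey_sum_closed)
  fix k l assume kl: "0 \<le> k" "k < l" "l \<le> m" "(k, l) \<noteq> (0, m)"
  then show "a k l \<in> C \<and> (\<exists>n. homog n (a k l))"
    using defining_systemD(1,2)[OF a] by blast
  show "d (a k l) = (\<Sum>r\<in>{k<..<l}. bar (a k r) * a r l)"
  proof (cases "l = Suc k")
    case True
    then have "{k<..<l} = {}" by auto
    then show ?thesis using defining_systemD(3)[OF a, of k] True kl by simp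
  next
    case False
    then show ?thesis using defining_systemD(5)[OF a] kl by simp
  qed
qed

section \<open>Defining systems of length three and four from named entries\<close>

lemma triple_massey_vanishesI:
  assumes C: "u \<in> C" "v \<in> C" "w \<in> C" "p \<in> C" "q \<in> C"
    and hom: "homog i u" "homog j v" "homog k w" "homog r p" "homog s q"
    and closed: "d u = 0" "d v = 0" "d w = 0"
    and x: "x 1 = cohom_class C d u" "x 2 = cohom_class C d v" "x 3 = cohom_class C d w"
    and eq: "d p = bar u * v" "d q = bar v * w"
    and ex: "exact (bar u * q + bar p * w)"
  shows "massey_vanishes C d 3 x"
proof -
  \<comment> \<open>By the wildcards the pair \<open>(0, 3)\<close>, which is excluded from a
    defining system, gets the default value \<open>p\<close>.\<close>
  define a where "a k l = (case (k, l) of (0, Suc 0) \<Rightarrow> u | (Suc 0, Suc (Suc 0)) \<Rightarrow> v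
    | (Suc (Suc 0), _) \<Rightarrow> w | (0, _) \<Rightarrow> p | (Suc 0, _) \<Rightarrow> q | _ \<Rightarrow> 0)" for k l :: nat
  have a: "a 0 1 = u" "a 1 2 = v" "a 2 3 = w" "a 0 2 = p" "a 1 3 = q"
    by (simp_all add: a_def numeral_eq_Suc)
  have ivl: "{0<..<2} = {1::nat}" "{1<..<3} = {2::nat}" "{0<..<3} = {1, 2::nat}" by auto
  have pairs: "(k, l) \<in> {(0, 1), (1, 2), (2, 3), (0, 2), (1, 3)}"
    if "k < l" "l \<le> 3" "(k, l) \<noteq> (0, 3)" for k l :: nat
    using that by auto
  have "\<exists>n. homog n u" "\<exists>n. homog n v" "\<exists>n. homog n w" "\<exists>n. homog n p" "\<exists>n. homog n q"
    using hom by blast+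
  note homs = this
  have entries: "\<forall>(k, l) \<in> {(0, 1), (1, 2), (2, 3), (0, 2), (1, 3)}.
      a k l \<in> C \<and> (\<exists>n. homog n (a k l))"
    by (simp only: ball_simps prod.case a C homs simp_thms)
  have sums: "sum f {1} = f 1" "sum f {2} = f 2" "sum f {1, 2} = f 1 + f 2"
    for f :: "nat \<Rightarrow> 'g fgca"
    by simp_all
  have sub: "1 - 1 = (0::nat)" "2 - 1 = (1::nat)" "3 - 1 = (2::nat)" by simp_all
  have classes: "\<forall>k \<in> {1, 2, 3}. d (a (k - 1) k) = 0 \<and> cohom_class C d (a (k - 1) k) = x k"
    by (simp only: ball_simps sub a closed x simp_thms)
  have equations: "\<forall>(k, l) \<in> {(0, 2), (1, 3)}. d (a k l) = (\<Sum>r\<in>{k<..<l}. bar (a k r) * a r l)"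
    by (simp only: ball_simps prod.case ivl sums a eq simp_thms)
  have "defining_system C d 3 x a"
    unfolding defining_system_def
  proof (intro conjI allI impI ballI)
    fix k l :: nat assume "k < l \<and> l \<le> 3 \<and> (k, l) \<noteq> (0, 3)"
    then have "(k, l) \<in> {(0, 1), (1, 2), (2, 3), (0, 2), (1, 3)}" by (elim conjE) (rule pairs)
    from bspec[OF entries this] have "a k l \<in> C \<and> (\<exists>n. homog n (a k l))"
      by (simp only: prod.case)
    then show "a k l \<in> C" "\<exists>n. homog n (a k l)" by blast+
  next
    fix k :: nat assume "k \<in> {1..3}"
    then have "k \<in> {1, 2, 3}" by auto
    then show "d (a (k - 1) k) = 0" "cohom_class C d (a (k - 1) k) = x k" using classes by blast+
  next
    fix k l :: nat assume kl: "k + 2 \<le> l \<and> l \<le> 3 \<and> (k, l) \<noteq> (0, 3)"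
    then have "(k, l) \<in> {(0, 2), (1, 3)}" by auto
    then show "d (a k l) = (\<Sum>r\<in>{k<..<l}. bar (a k r) * a r l)" using equations by blast
  qed
  moreover have "(\<Sum>l\<in>{0<..<3}. bar (a 0 l) * a l 3) = bar u * q + bar p * w"
    by (simp only: ivl sums a)
  ultimately show ?thesis using ex by (intro massey_vanishesI) auto
qed

lemma quadruple_massey_vanishesI:
  assumes C: "u \<in> C" "v \<in> C" "w \<in> C" "y \<in> C" "p \<in> C" "q \<in> C" "r \<in> C" "b \<in> C" "c \<in> C"
    and hom: "homog i1 u" "homog i2 v" "homog i3 w" "homog i4 y" "homog i5 p" "homog i6 q"
      "homog i7 r" "homog i8 b" "homog i9 c"
    and closed: "d u = 0" "d v = 0" "d w = 0" "d y = 0"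
    and x: "x 1 = cohom_class C d u" "x 2 = cohom_class C d v" "x 3 = cohom_class C d w"
      "x 4 = cohom_class C d y"
    and eq: "d p = bar u * v" "d q = bar v * w" "d r = bar w * y"
      "d b = bar u * q + bar p * w" "d c = bar v * r + bar q * y"
    and ex: "exact (bar u * c + bar p * r + bar b * y)"
  shows "massey_vanishes C d 4 x"
proof -
  \<comment> \<open>Here the excluded pair is \<open>(0, 4)\<close>, with default value
    \<open>b\<close>.\<close>
  define a where "a k l = (case (k, l) of (0, Suc 0) \<Rightarrow> u | (Suc 0, Suc (Suc 0)) \<Rightarrow> v
    | (Suc (Suc 0), Suc (Suc (Suc 0))) \<Rightarrow> w | (Suc (Suc (Suc 0)), _) \<Rightarrow> y
    | (0, Suc (Suc 0)) \<Rightarrow> p | (Suc 0, Suc (Suc (Suc 0))) \<Rightarrow> q | (Suc (Suc 0), _) \<Rightarrow> r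
    | (0, _) \<Rightarrow> b | (Suc 0, _) \<Rightarrow> c | _ \<Rightarrow> 0)" for k l :: nat
  have a: "a 0 1 = u" "a 1 2 = v" "a 2 3 = w" "a 3 4 = y" "a 0 2 = p" "a 1 3 = q" "a 2 4 = r"
    "a 0 3 = b" "a 1 4 = c"
    by (simp_all add: a_def numeral_eq_Suc)
  have ivl: "{0<..<2} = {1::nat}" "{1<..<3} = {2::nat}" "{2<..<4} = {3::nat}"
      "{0<..<3} = {1, 2::nat}" "{1<..<4} = {2, 3::nat}" "{0<..<4} = {1, 2, 3::nat}" by auto
  have pairs: "(k, l) \<in> {(0, 1), (1, 2), (2, 3), (3, 4), (0, 2), (1, 3), (2, 4), (0, 3), (1, 4)}"
    if kl: "k < l" "l \<le> 4" "(k, l) \<noteq> (0, 4)" for k l :: nat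
  proof -
    have "k = 0 \<or> k = 1 \<or> k = 2 \<or> k = 3" "l = 1 \<or> l = 2 \<or> l = 3 \<or> l = 4"
      using kl by linarith+
    then show ?thesis by (elim disjE) (use kl in simp_all)
  qed
  have "\<exists>n. homog n u" "\<exists>n. homog n v" "\<exists>n. homog n w" "\<exists>n. homog n y"
      "\<exists>n. homog n p" "\<exists>n. homog n q" "\<exists>n. homog n r"
      "\<exists>n. homog n b" "\<exists>n. homog n c"
    using hom by blast+
  note homs = this
  have entries: "\<forall>(k, l) \<in> {(0, 1), (1, 2), (2, 3), (3, 4), (0, 2), (1, 3), (2, 4), (0, 3), (1, 4)}.
      a k l \<in> C \<and> (\<exists>n. homog n (a k l))"
    by (simp only: ball_simps prod.case a C homs simp_thms)
  have sums: "sum f {1} = f 1" "sum f {2} = f 2" "sum f {3} = f 3"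
      "sum f {1, 2} = f 1 + f 2" "sum f {2, 3} = f 2 + f 3"
      "sum f {1, 2, 3} = f 1 + (f 2 + f 3)"
    for f :: "nat \<Rightarrow> 'g fgca"
    by simp_all
  have sub: "1 - 1 = (0::nat)" "2 - 1 = (1::nat)" "3 - 1 = (2::nat)" "4 - 1 = (3::nat)" by simp_all
  have classes: "\<forall>k \<in> {1, 2, 3, 4}. d (a (k - 1) k) = 0 \<and> cohom_class C d (a (k - 1) k) = x k"
    by (simp only: ball_simps sub a closed x simp_thms)
  have equations: "\<forall>(k, l) \<in> {(0, 2), (1, 3), (2, 4), (0, 3), (1, 4)}.
      d (a k l) = (\<Sum>r\<in>{k<..<l}. bar (a k r) * a r l)"
    by (simp only: ball_simps prod.case ivl sums a eq simp_thms)
  have "defining_system C d 4 x a"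
    unfolding defining_system_def
  proof (intro conjI allI impI ballI)
    fix k l :: nat assume "k < l \<and> l \<le> 4 \<and> (k, l) \<noteq> (0, 4)"
    then have "(k, l) \<in> {(0, 1), (1, 2), (2, 3), (3, 4), (0, 2), (1, 3), (2, 4), (0, 3), (1, 4)}"
      by (elim conjE) (rule pairs)
    from bspec[OF entries this] have "a k l \<in> C \<and> (\<exists>n. homog n (a k l))"
      by (simp only: prod.case)
    then show "a k l \<in> C" "\<exists>n. homog n (a k l)" by blast+
  next
    fix k :: nat assume "k \<in> {1..4}"
    then have "k \<in> {1, 2, 3, 4}" by auto
    then show "d (a (k - 1) k) = 0" "cohom_class C d (a (k - 1) k) = x k" using classes by blast+
  next
    fix k l :: nat assume kl: "k + 2 \<le> l \<and> l \<le> 4 \<and> (k, l) \<noteq> (0, 4)"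
    then have "(k, l) \<in> {(0, 2), (1, 3), (2, 4), (0, 3), (1, 4)}" by auto
    then show "d (a k l) = (\<Sum>r\<in>{k<..<l}. bar (a k r) * a r l)" using equations by blast
  qed
  moreover have "(\<Sum>l\<in>{0<..<4}. bar (a 0 l) * a l 4) = bar u * c + bar p * r + bar b * y"
    by (simp only: ivl sums a add.assoc)
  ultimately show ?thesis using ex by (intro massey_vanishesI) auto
qed

end

text \<open>The number of inversions is additive in both arguments, so the sign is a product over
  pairs of factors. In this form the simplifier can evaluate it on explicit monomials.\<close>

lemma koszul_prod:
  "koszul M N = (if monomial (M + N)
     then \<Prod>x\<in>#M. \<Prod>y\<in>#N. if odd (gdeg x) \<and> odd (gdeg y) \<and> y < x then -1 else 1 else 0)"
proof -
  have single: "inversions {#x#} {#y#}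
      = (if odd (gdeg x) \<and> odd (gdeg y) \<and> y < x then {(x, y)} else {})"
    for x y :: 'a
    by (auto simp: inversions_def)
  have right: "(-1 :: rat) ^ card (inversions {#x#} N)
      = (\<Prod>y\<in>#N. if odd (gdeg x) \<and> odd (gdeg y) \<and> y < x then -1 else 1)"
    if "monomial N" for x :: 'a and N
    using that
  proof (induction N)
    case empty
    then show ?case by (simp add: inversions_def)
  next
    case (add y N)
    have "(-1 :: rat) ^ card (inversions {#x#} (add_mset y N))
        = (-1) ^ card (inversions {#x#} {#y#}) * (-1) ^ card (inversions {#x#} N)"
      using card_inversions_add_right[of "{#y#}" N "{#x#}"] add.prems by (simp add: power_add)
    then show ?case using add by (simp add: single)
  qed
  have "(-1 :: rat) ^ card (inversions M N)
      = (\<Prod>x\<in>#M. \<Prod>y\<in>#N. if odd (gdeg x) \<and> odd (gdeg y) \<and> y < x then -1 else 1)"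
    if "monomial M" "monomial N" for M N :: "'a multiset"
    using that
  proof (induction M)
    case empty
    then show ?case by (simp add: inversions_def)
  next
    case (add x M)
    have "(-1 :: rat) ^ card (inversions (add_mset x M) N)
        = (-1) ^ card (inversions {#x#} N) * (-1) ^ card (inversions M N)"
      using card_inversions_add_left[of "{#x#}" M N] add.prems by (simp add: power_add)
    then show ?case using add by (simp add: right)
  qed
  then show ?thesis
    unfolding koszul_def using monomial_add_left[of M N] monomial_add_right[of M N]
    by (cases "monomial (M + N)") simp_all
qed

lemma represents_basis_independent:
  assumes "represents_basis C d n K z" "finite F" "F \<subseteq> K"
    "(\<Sum>k\<in>F. smult (c k) (z k)) \<in> coboundaries C d" "k \<in> F"
  shows "c k = 0"
  using assms(1)[unfolded represents_basis_def, THEN conjunct2, THEN conjunct1,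
      rule_format, of F c k] assms(2-5) by simp

lemma represents_basis_spanning:
  assumes "represents_basis C d n K z" "w \<in> cocycles C d n"
  obtains F c where "finite F" "F \<subseteq> K" "w - (\<Sum>k\<in>F. smult (c k) (z k)) \<in> coboundaries C d"
  using assms(1)[unfolded represents_basis_def, THEN conjunct2, THEN conjunct2,
      rule_format, OF assms(2)]
  by blast

section \<open>Monomials of low degree, and generators added to kill cohomology\<close>

context cdga
begin

lemma d_gen_mult:
  assumes "x \<in> G" "v \<in> C"
  shows "even (gdeg x) \<Longrightarrow> d (gen x * v) = d (gen x) * v + gen x * d v"
    and "odd (gdeg x) \<Longrightarrow> d (gen x * v) = d (gen x) * v - gen x * d v"
  using d_mult[of "gen x" v "gdeg x"] assms homog_gen by auto

lemma mdeg_0: "set_mset M \<subseteq> G \<Longrightarrow> mdeg M = 0 \<Longrightarrow> M = {#}"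
  using gdeg_ge_2 by (cases M) fastforce+

lemma mdeg_1: "set_mset M \<subseteq> G \<Longrightarrow> mdeg M \<noteq> 1"
  using gdeg_ge_2 by (cases M) fastforce+

text \<open>Here and up to degree six one factor is split off, and the rest cannot have degree one.
  These case lists, with factors by increasing degree, later bound the supports of cocycles.\<close>

lemma mdeg_2:
  assumes "set_mset M \<subseteq> G" "mdeg M = 2"
  obtains x where "M = {#x#}" "x \<in> G" "gdeg x = 2"
proof (cases M)
  case (add x N)
  then show ?thesis using assms gdeg_ge_2[of x] mdeg_0[of N] that[of x] by auto
qed (use assms in simp)

lemma mdeg_3:
  assumes "set_mset M \<subseteq> G" "mdeg M = 3"
  obtains x where "M = {#x#}" "x \<in> G" "gdeg x = 3"
proof (cases M)
  case (add x N)
  then have "gdeg x = 3 \<or> gdeg x = 2" using assms gdeg_ge_2[of x] mdeg_1[of N] by auto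
  then show ?thesis using add assms mdeg_0[of N] mdeg_1[of N] that[of x] by auto
qed (use assms in simp)

lemma mdeg_4:
  assumes "set_mset M \<subseteq> G" "mdeg M = 4"
  obtains x where "M = {#x#}" "x \<in> G" "gdeg x = 4"
    | x y where "M = {#x, y#}" "x \<in> G" "y \<in> G" "gdeg x = 2" "gdeg y = 2"
proof (cases M)
  case (add x N)
  then have "gdeg x = 4 \<or> gdeg x = 3 \<or> gdeg x = 2" using assms gdeg_ge_2[of x] by auto
  moreover have "gdeg x \<noteq> 3" using add assms mdeg_1[of N] by auto
  ultimately consider "gdeg x = 4" "mdeg N = 0" | "gdeg x = 2" "mdeg N = 2"
    using add assms by auto
  then show ?thesis
  proof cases
    case 1
    then show ?thesis using add assms mdeg_0[of N] that(1)[of x] by auto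
  next
    case 2
    obtain y where "N = {#y#}" "y \<in> G" "gdeg y = 2" using mdeg_2[of N] 2 add assms by auto
    then show ?thesis using add assms that(2)[of x y] 2 by auto
  qed
qed (use assms in simp)

lemma mdeg_5:
  assumes "set_mset M \<subseteq> G" "mdeg M = 5"
  obtains x where "M = {#x#}" "x \<in> G" "gdeg x = 5"
    | x y where "M = {#x, y#}" "x \<in> G" "y \<in> G" "gdeg x = 2" "gdeg y = 3"
proof (cases M)
  case (add x N)
  then have "gdeg x = 5 \<or> gdeg x = 4 \<or> gdeg x = 3 \<or> gdeg x = 2" using assms gdeg_ge_2[of x] by auto
  moreover have "gdeg x \<noteq> 4" using add assms mdeg_1[of N] by auto
  ultimately consider "gdeg x = 5" "mdeg N = 0" | "gdeg x = 3" "mdeg N = 2"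
    | "gdeg x = 2" "mdeg N = 3"
    using add assms by auto
  then show ?thesis
  proof cases
    case 1
    then show ?thesis using add assms mdeg_0[of N] that(1)[of x] by auto
  next
    case 2
    obtain y where "N = {#y#}" "y \<in> G" "gdeg y = 2" using mdeg_2[of N] 2 add assms by auto
    then show ?thesis using add assms that(2)[of y x] 2 by (auto simp: add_mset_commute)
  next
    case 3
    obtain y where "N = {#y#}" "y \<in> G" "gdeg y = 3" using mdeg_3[of N] 3 add assms by auto
    then show ?thesis using add assms that(2)[of x y] 3 by auto
  qed
qed (use assms in simp)

lemma mdeg_6:
  assumes "set_mset M \<subseteq> G" "mdeg M = 6"
  obtains x where "M = {#x#}" "x \<in> G" "gdeg x = 6"
    | x y where "M = {#x, y#}" "x \<in> G" "y \<in> G" "gdeg x = 2" "gdeg y = 4"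
    | x y where "M = {#x, y#}" "x \<in> G" "y \<in> G" "gdeg x = 3" "gdeg y = 3"
    | x y z where "M = {#x, y, z#}" "x \<in> G" "y \<in> G" "z \<in> G" "gdeg x = 2" "gdeg y = 2" "gdeg z = 2"
proof (cases M)
  case (add x N)
  then have "gdeg x = 6 \<or> gdeg x = 5 \<or> gdeg x = 4 \<or> gdeg x = 3 \<or> gdeg x = 2"
    using assms gdeg_ge_2[of x] by auto
  moreover have "gdeg x \<noteq> 5" using add assms mdeg_1[of N] by auto
  ultimately consider "gdeg x = 6" "mdeg N = 0" | "gdeg x = 4" "mdeg N = 2"
    | "gdeg x = 3" "mdeg N = 3"
    | "gdeg x = 2" "mdeg N = 4"
    using add assms by auto
  then show ?thesis
  proof cases
    case 1
    then show ?thesis using add assms mdeg_0[of N] that(1)[of x] by auto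
  next
    case 2
    obtain y where "N = {#y#}" "y \<in> G" "gdeg y = 2" using mdeg_2[of N] 2 add assms by auto
    then show ?thesis using add assms that(2)[of y x] 2 by (auto simp: add_mset_commute)
  next
    case 3
    obtain y where "N = {#y#}" "y \<in> G" "gdeg y = 3" using mdeg_3[of N] 3 add assms by auto
    then show ?thesis using add assms that(3)[of x y] 3 by auto
  next
    case 4
    have N: "set_mset N \<subseteq> G" using add assms by auto
    show ?thesis using N 4(2)
    proof (cases rule: mdeg_4)
      case (1 y)
      then show ?thesis using add assms that(2)[of x y] 4 by auto
    next
      case (2 y z)
      then show ?thesis using add assms that(4)[of x y z] 4 by auto
    qed
  qed
qed (use assms in simp)

text \<open>A monomial of degree \<open>n\<close> containing some \<open>e k\<close> is
  \<open>e k\<close> itself, so \<open>z\<close> differs from an element of \<open>Lam H\<close> by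
  a linear combination of new generators. As \<open>d z = 0\<close>, the same combination of the
  \<open>d (gen (e k))\<close> is a coboundary in \<open>Lam H\<close>, and independence kills its
  coefficients.\<close>

lemma cocycle_without_new_generators:
  assumes basis: "represents_basis (Lam H) d (n + 1) K (\<lambda>k. d (gen (e k)))"
    and e: "H \<union> e ` K \<subseteq> G" "inj e" "e ` K \<inter> H = {}" "\<And>k. gdeg (e k) = n"
    and z: "z \<in> Lam (H \<union> e ` K)" "homog n z" "d z = 0"
  shows "z \<in> Lam H"
proof -
  define F where "F = {k \<in> K. coeff z {#e k#} \<noteq> 0}"
  have "inj_on (\<lambda>k. {#e k#}) F" using e(2) by (auto simp: inj_on_def dest: injD)
  moreover have "(\<lambda>k. {#e k#}) ` F \<subseteq> support z" by (auto simp: F_def)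
  ultimately have F: "finite F" using finite_support finite_subset finite_imageD by metis
  let ?w = "\<Sum>k\<in>F. smult (coeff z {#e k#}) (gen (e k))"
  have coeff_w: "coeff ?w M = (\<Sum>k\<in>F. if M = {#e k#} then coeff z {#e k#} else 0)" for M
    unfolding coeff_sum
    by (intro sum.cong) (auto simp: gen_eq_mon coeff_mon coeff_not_monomial monomial_def)
  have zG: "z \<in> C" using z(1) e(1) Lam_mono by blast
  have zw: "z - ?w \<in> Lam H"
    unfolding Lam_iff
  proof (intro allI impI)
    fix M assume M: "coeff (z - ?w) M \<noteq> 0"
    have zM: "coeff z M \<noteq> 0"
    proof
      assume "coeff z M = 0"
      then have "coeff ?w M = 0" unfolding coeff_w by (intro sum.neutral) auto
      then show False using M \<open>coeff z M = 0\<close> by simp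
    qed
    then have sub: "set_mset M \<subseteq> H \<union> e ` K" and deg: "mdeg M = n"
      using z by (auto simp: Lam_iff homog_iff)
    show "set_mset M \<subseteq> H"
    proof (rule ccontr)
      assume "\<not> set_mset M \<subseteq> H"
      then obtain k where k: "k \<in> K" "e k \<in># M" using sub by auto
      then obtain N where N: "M = add_mset (e k) N" by (meson multi_member_split)
      then have "mdeg N = 0" using deg e(4) by simp
      then have "N = {#}" using N sub e(1) by (intro mdeg_0) auto
      then have Mk: "M = {#e k#}" using N by simp
      then have "k \<in> F" using k zM by (simp add: F_def)
      have "coeff ?w M = (\<Sum>k'\<in>F. if k' = k then coeff z {#e k#} else 0)"
        unfolding coeff_w using Mk e(2) by (intro sum.cong) (auto dest: injD)
      also have "\<dots> = coeff z M" using F \<open>k \<in> F\<close> Mk by simp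
      finally show False using M by simp
    qed
  qed
  have gC: "gen (e k) \<in> C" if "k \<in> F" for k using that e(1) by (auto simp: F_def)
  then have wC: "?w \<in> C" by (intro Lam_sum) simp
  have "(\<Sum>k\<in>F. smult (coeff z {#e k#}) (d (gen (e k)))) = d ?w"
    using gC by (subst d_sum) auto
  also have "\<dots> = d (- (z - ?w))" using zG wC z(3) by simp
  also have "\<dots> \<in> coboundaries (Lam H) d" using zw unfolding coboundaries_def by blast
  finally have dw: "(\<Sum>k\<in>F. smult (coeff z {#e k#}) (d (gen (e k)))) \<in> coboundaries (Lam H) d" .
  have "F \<subseteq> K" by (auto simp: F_def)
  then have "coeff z {#e k#} = 0" if "k \<in> F" for k
    using represents_basis_independent[where c = "\<lambda>k. coeff z {#e k#}", OF basis F _ dw that]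
    by blast
  then have "F = {}" by (auto simp: F_def)
  then show ?thesis using zw by simp
qed

text \<open>Modulo coboundaries of \<open>Lam H\<close>, \<open>z\<close> is a combination of the
  basis cocycles, and each of these is the differential of a new generator.\<close>

lemma exact_of_basis:
  assumes basis: "represents_basis (Lam H) d (n + 1) K (\<lambda>k. d (gen (e k)))"
    and e: "H \<union> e ` K \<subseteq> G"
    and z: "z \<in> Lam H" "homog (n + 1) z" "d z = 0"
  shows "exact z"
proof -
  have "z \<in> cocycles (Lam H) d (n + 1)" using z by (simp add: cocycles_def)
  then obtain F c where F: "finite F" "F \<subseteq> K"
      "z - (\<Sum>k\<in>F. smult (c k) (d (gen (e k)))) \<in> coboundaries (Lam H) d"
    using represents_basis_spanning[OF basis] by blast
  then obtain w where w: "w \<in> Lam H" "z - (\<Sum>k\<in>F. smult (c k) (d (gen (e k)))) = d w"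
    by (auto simp: coboundaries_def)
  have gC: "gen (e k) \<in> C" if "k \<in> F" for k using that e F(2) by (intro Lam_gen) auto
  have wC: "w \<in> C" using w(1) e Lam_mono by blast
  have "z = d (w + (\<Sum>k\<in>F. smult (c k) (gen (e k))))"
  proof (subst d_add)
    show "(\<Sum>k\<in>F. smult (c k) (gen (e k))) \<in> C" using gC by (intro Lam_sum) simp
    show "z = d w + d (\<Sum>k\<in>F. smult (c k) (gen (e k)))"
      using w(2) gC by (subst d_sum) (auto simp: algebra_simps)
  qed (rule wC)
  then show ?thesis using wC gC by (intro exactI) (auto intro!: Lam_add Lam_sum)
qed

text \<open>Next to a generator of degree \<open>n\<close> there would have to be a factor of degree
  one.\<close>

lemma without_generators_of_codegree_1:
  assumes "z \<in> Lam (H \<union> e ` K)" "homog (n + 1) z" "H \<union> e ` K \<subseteq> G" "\<And>k. gdeg (e k) = n"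
  shows "z \<in> Lam H"
  unfolding Lam_iff
proof (intro allI impI)
  fix M assume "coeff z M \<noteq> 0"
  then have sub: "set_mset M \<subseteq> H \<union> e ` K" and deg: "mdeg M = n + 1"
    using assms by (auto simp: Lam_iff homog_iff)
  show "set_mset M \<subseteq> H"
  proof (rule ccontr)
    assume "\<not> set_mset M \<subseteq> H"
    then obtain k where k: "k \<in> K" "e k \<in># M" using sub by auto
    then obtain N where N: "M = add_mset (e k) N" by (meson multi_member_split)
    then have "mdeg N = 1" using deg assms(4) by simp
    moreover have "set_mset N \<subseteq> G" using N sub assms(3) by auto
    ultimately show False using mdeg_1 by blast
  qed
qed

end

section \<open>The cohomology of B\<close>

locale cdga_B =
  fixes I J :: "nat \<Rightarrow> nat set" and d :: "bgen fgca \<Rightarrow> bgen fgca"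
  assumes constr: "constructs_B I J d"
begin

abbreviation "GA \<equiv> V_gens I"
abbreviation "GB \<equiv> V_gens I \<union> W_gens J"

lemma gdeg_ge_2_B: "x \<in> GB \<Longrightarrow> 2 \<le> gdeg x"
  by (auto simp: V_gens_def W_gens_def)

sublocale cdga GB d
  using constr gdeg_ge_2_B by unfold_locales (auto simp: constructs_B_def)

lemma constrA: "constructs_A I d"
  using constr by (simp add: constructs_B_def)

lemma basis_W: "6 \<le> n \<Longrightarrow> represents_basis (Lam (GA \<union> gens_below n (W_gens J))) d (n + 1) (J n)
    (\<lambda>k. d (gen (Wg n k)))"
  using constr by (simp add: constructs_B_def)

lemma basis_V: "6 \<le> n \<Longrightarrow> represents_basis (Lam (gens_below n GA)) d (n + 1) (I n)
    (\<lambda>k. d (gen (Vg n k)))"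
  using constrA by (simp add: constructs_A_def)

lemma gens_below_Suc_W: "6 \<le> n \<Longrightarrow>
    gens_below (Suc n) (W_gens J) = gens_below n (W_gens J) \<union> Wg n ` J n"
  by (auto simp: gens_below_def W_gens_def less_Suc_eq)

text \<open>Only \<open>W\<close> is truncated by degree, because every stage in the construction of
  B contains all of A.\<close>

lemma Lam_degree_bound:
  assumes "z \<in> C" "homog n z"
  shows "z \<in> Lam (GA \<union> gens_below (Suc n) (W_gens J))"
  unfolding Lam_iff
proof (intro allI impI subsetI)
  fix M x assume M: "coeff z M \<noteq> 0" "x \<in># M"
  then have "x \<in> GB" "mdeg M = n" using assms by (auto simp: Lam_iff homog_iff)
  moreover obtain N where "M = add_mset x N" using M(2) by (meson multi_member_split)
  ultimately show "x \<in> GA \<union> gens_below (Suc n) (W_gens J)"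
    by (auto simp: gens_below_def)
qed

lemma cocycle_below_degree:
  assumes "6 \<le> n" "z \<in> C" "homog n z" "d z = 0"
  shows "z \<in> Lam (GA \<union> gens_below n (W_gens J))"
proof (rule cocycle_without_new_generators[OF basis_W[OF assms(1)] _ _ _ _ _ assms(3,4)])
  show "z \<in> Lam (GA \<union> gens_below n (W_gens J) \<union> Wg n ` J n)"
    using Lam_degree_bound[OF assms(2,3)] gens_below_Suc_W[OF assms(1)] by (simp add: Un_assoc)
  have "Wg n ` J n \<subseteq> W_gens J" using assms(1) by (auto simp: W_gens_def)
  then show "GA \<union> gens_below n (W_gens J) \<union> Wg n ` J n \<subseteq> GB"
    by (auto simp: gens_below_def)
  show "Wg n ` J n \<inter> (GA \<union> gens_below n (W_gens J)) = {}"
    by (auto simp: gens_below_def V_gens_def)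
qed (simp_all add: inj_def)

text \<open>A cocycle of degree \<open>n + 1\<close> avoids the \<open>W\<close> generators of
  degree \<open>n + 1\<close> by independence and those of degree \<open>n\<close> for lack of
  elements of degree one. So it lives in the stage whose cohomology of degree \<open>n + 1\<close>
  the generators of degree \<open>n\<close> kill.\<close>

lemma cocycle_ge_7_exact:
  assumes "7 \<le> k" "z \<in> C" "homog k z" "d z = 0"
  shows "exact z"
proof -
  obtain n where k: "k = n + 1" "6 \<le> n" using assms(1) by (cases k) auto
  have "Wg n ` J n \<subseteq> W_gens J" using k(2) by (auto simp: W_gens_def)
  then have sub: "GA \<union> gens_below n (W_gens J) \<union> Wg n ` J n \<subseteq> GB"
    by (auto simp: gens_below_def)
  have "z \<in> Lam (GA \<union> gens_below n (W_gens J) \<union> Wg n ` J n)"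
    using cocycle_below_degree[of k z] assms k gens_below_Suc_W[OF k(2)] by (simp add: Un_assoc)
  then have "z \<in> Lam (GA \<union> gens_below n (W_gens J))"
    by (rule without_generators_of_codegree_1[where n = n]) (use assms(3) k sub in simp_all)
  then show ?thesis
    by (rule exact_of_basis[OF basis_W[OF k(2)] sub]) (use assms(3,4) k in simp_all)
qed

end

text \<open>A list instead of a set, so that simplification unfolds the sum into explicit terms with
  unknown coefficients.\<close>

lemma fgca_expand_list:
  assumes "support z \<subseteq> set L" "distinct L"
  obtains k where "z = (\<Sum>M\<leftarrow>L. smult (k M) (mon M))"
proof -
  have "z = (\<Sum>M\<in>support z. smult (coeff z M) (mon M))" by (rule fgca_expand)
  also have "\<dots> = (\<Sum>M\<in>set L. smult (coeff z M) (mon M))"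
    using assms(1) by (intro sum.mono_neutral_left) (auto simp: smult_simps)
  also have "\<dots> = (\<Sum>M\<leftarrow>L. smult (coeff z M) (mon M))"
    using assms(2) by (rule sum.distinct_set_conv_list)
  finally show ?thesis by (rule that)
qed

section \<open>Explicit differentials and cocycles of B in degrees up to six\<close>

context cdga_B
begin

lemma gens_mem [simp]:
  "Xg \<in> GA" "Yg \<in> GA" "ag \<in> GA" "bg \<in> GA" "cg \<in> GA" "eg \<in> GA" "fg \<in> GA" "hg \<in> GA" "ig \<in> GA"
  "alphag \<in> W_gens J" "gammag \<in> W_gens J" "sXalphag \<in> W_gens J" "sYalphag \<in> W_gens J"
  "sXgammag \<in> W_gens J" "sYgammag \<in> W_gens J" "1 \<le> k \<Longrightarrow> k \<le> 9 \<Longrightarrow> tg k \<in> W_gens J"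
  by (simp_all add: V_gens_def W_gens_def)

lemma d_gens [simp]:
  "d eX = 0" "d eY = 0" "d ea = eX * eX" "d eb = eX * eY" "d ec = eY * eY"
  "d ee = eY * ea - eX * eb" "d ef = eY * eb - eX * ec"
  "d eh = eX * ee + ea * eb" "d ei = eY * ef + eb * ec"
  using constrA by (simp_all add: constructs_A_def)

lemma d_W_gens [simp]:
  "d ealpha = 0" "d egamma = 0" "d esXalpha = eX * ealpha" "d esYalpha = eY * ealpha"
  "d esXgamma = eX * egamma" "d esYgamma = eY * egamma"
  "d (gen (tg (Suc 0))) = em - ealpha * egamma"
  "d (gen (tg 2)) = eY * esXalpha - eX * esYalpha"
  "d (gen (tg 3)) = eY * esXgamma - eX * esYgamma"
  "d (gen (tg 4)) = ea * ealpha - eX * esXalpha"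
  "d (gen (tg 5)) = eb * ealpha - eX * esYalpha"
  "d (gen (tg 6)) = ec * ealpha - eY * esYalpha"
  "d (gen (tg 7)) = ea * egamma - eX * esXgamma"
  "d (gen (tg 8)) = eb * egamma - eX * esYgamma"
  "d (gen (tg 9)) = ec * egamma - eY * esYgamma"
  using constr by (simp_all add: constructs_B_def)

lemma gens_degree:
  assumes "x \<in> GB"
  shows "gdeg x = 2 \<Longrightarrow> x \<in> {Xg, Yg}"
    and "gdeg x = 3 \<Longrightarrow> x \<in> {ag, bg, cg, alphag, gammag}"
    and "gdeg x = 4 \<Longrightarrow> x \<in> {eg, fg, sXalphag, sYalphag, sXgammag, sYgammag}"
    and "gdeg x = 5 \<Longrightarrow> x \<in> {hg, ig, tg 1, tg 2, tg 3, tg 4, tg 5, tg 6, tg 7, tg 8, tg 9}"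
proof -
  have t: "tg k \<in> {tg 1, tg 2, tg 3, tg 4, tg 5, tg 6, tg 7, tg 8, tg 9}" if "k \<in> {1..9}" for k
  proof -
    have "k = 1 \<or> k = 2 \<or> k = 3 \<or> k = 4 \<or> k = 5 \<or> k = 6 \<or> k = 7 \<or> k = 8 \<or> k = 9"
      using that by auto
    then show ?thesis by auto
  qed
  show "gdeg x = 2 \<Longrightarrow> x \<in> {Xg, Yg}"
    "gdeg x = 3 \<Longrightarrow> x \<in> {ag, bg, cg, alphag, gammag}"
    "gdeg x = 4 \<Longrightarrow> x \<in> {eg, fg, sXalphag, sYalphag, sXgammag, sYgammag}"
    using assms by (auto simp: V_gens_def W_gens_def)
  show "gdeg x = 5 \<Longrightarrow> x \<in> {hg, ig, tg 1, tg 2, tg 3, tg 4, tg 5, tg 6, tg 7, tg 8, tg 9}"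
    using assms t unfolding V_gens_def W_gens_def by fastforce
qed

lemma mon_gens:
  "mon {#x#} = gen x"
  "even (gdeg x) \<or> x \<le> y \<Longrightarrow> mon {#x, y#} = gen x * gen y"
  "even (gdeg x) \<Longrightarrow> even (gdeg y) \<Longrightarrow> mon {#x, y, z#} = gen x * (gen y * gen z)"
  by (simp add: gen_eq_mon) (simp_all add: gen_mult_gen gen_mult_mon)

lemma d_degree_3:
  "d (mon {#ag#}) = mon {#Xg, Xg#}"
  "d (mon {#bg#}) = mon {#Xg, Yg#}"
  "d (mon {#cg#}) = mon {#Yg, Yg#}"
  "d (mon {#alphag#}) = 0"
  "d (mon {#gammag#}) = 0"
  by (simp_all add: d_gen_mult mon_gens em_def less_eq_bgen_def)

lemma d_degree_5:
  "d (mon {#hg#}) = mon {#Xg, eg#} + mon {#ag, bg#}"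
  "d (mon {#ig#}) = mon {#Yg, fg#} + mon {#bg, cg#}"
  "d (mon {#tg (Suc 0)#}) = mon {#Yg, eg#} + mon {#ag, cg#} + mon {#Xg, fg#}
     - mon {#alphag, gammag#}"
  "d (mon {#tg 2#}) = mon {#Yg, sXalphag#} - mon {#Xg, sYalphag#}"
  "d (mon {#tg 3#}) = mon {#Yg, sXgammag#} - mon {#Xg, sYgammag#}"
  "d (mon {#tg 4#}) = mon {#ag, alphag#} - mon {#Xg, sXalphag#}"
  "d (mon {#tg 5#}) = mon {#bg, alphag#} - mon {#Xg, sYalphag#}"
  "d (mon {#tg 6#}) = mon {#cg, alphag#} - mon {#Yg, sYalphag#}"
  "d (mon {#tg 7#}) = mon {#ag, gammag#} - mon {#Xg, sXgammag#}"
  "d (mon {#tg 8#}) = mon {#bg, gammag#} - mon {#Xg, sYgammag#}"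
  "d (mon {#tg 9#}) = mon {#cg, gammag#} - mon {#Yg, sYgammag#}"
  "d (mon {#Xg, ag#}) = mon {#Xg, Xg, Xg#}"
  "d (mon {#Xg, bg#}) = mon {#Xg, Xg, Yg#}"
  "d (mon {#Xg, cg#}) = mon {#Xg, Yg, Yg#}"
  "d (mon {#Yg, ag#}) = mon {#Xg, Xg, Yg#}"
  "d (mon {#Yg, bg#}) = mon {#Xg, Yg, Yg#}"
  "d (mon {#Yg, cg#}) = mon {#Yg, Yg, Yg#}"
  "d (mon {#Xg, alphag#}) = 0"
  "d (mon {#Xg, gammag#}) = 0"
  "d (mon {#Yg, alphag#}) = 0"
  "d (mon {#Yg, gammag#}) = 0"
  by (simp_all add: d_gen_mult mon_gens em_def less_eq_bgen_def)
    (simp_all add: gen_eq_mon mult_mon koszul_prod smult_simps add_mset_commute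
      distrib_left distrib_right left_diff_distrib right_diff_distrib)

text \<open>Degree six is tabulated separately for A and for monomials with a factor from
  \<open>W\<close>, since \<open>cocycle_6_eq\<close> treats these parts by different arguments.
  Generators of degree six are excluded there beforehand.\<close>

lemma d_degree_6:
  "d (mon {#Xg, Xg, Xg#}) = 0"
  "d (mon {#Xg, Xg, Yg#}) = 0"
  "d (mon {#Xg, Yg, Yg#}) = 0"
  "d (mon {#Yg, Yg, Yg#}) = 0"
  "d (mon {#Xg, eg#}) = mon {#Xg, Yg, ag#} - mon {#Xg, Xg, bg#}"
  "d (mon {#Xg, fg#}) = mon {#Xg, Yg, bg#} - mon {#Xg, Xg, cg#}"
  "d (mon {#Yg, eg#}) = mon {#Yg, Yg, ag#} - mon {#Xg, Yg, bg#}"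
  "d (mon {#Yg, fg#}) = mon {#Yg, Yg, bg#} - mon {#Xg, Yg, cg#}"
  "d (mon {#ag, bg#}) = mon {#Xg, Xg, bg#} - mon {#Xg, Yg, ag#}"
  "d (mon {#ag, cg#}) = mon {#Xg, Xg, cg#} - mon {#Yg, Yg, ag#}"
  "d (mon {#bg, cg#}) = mon {#Xg, Yg, cg#} - mon {#Yg, Yg, bg#}"
  by (simp_all add: d_gen_mult mon_gens em_def less_eq_bgen_def)
    (simp_all add: gen_eq_mon mult_mon koszul_prod smult_simps add_mset_commute
      distrib_left distrib_right left_diff_distrib right_diff_distrib)

lemma d_degree_6_W:
  "d (mon {#Xg, sXalphag#}) = mon {#Xg, Xg, alphag#}"
  "d (mon {#Xg, sYalphag#}) = mon {#Xg, Yg, alphag#}"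
  "d (mon {#Yg, sXalphag#}) = mon {#Xg, Yg, alphag#}"
  "d (mon {#Yg, sYalphag#}) = mon {#Yg, Yg, alphag#}"
  "d (mon {#Xg, sXgammag#}) = mon {#Xg, Xg, gammag#}"
  "d (mon {#Xg, sYgammag#}) = mon {#Xg, Yg, gammag#}"
  "d (mon {#Yg, sXgammag#}) = mon {#Xg, Yg, gammag#}"
  "d (mon {#Yg, sYgammag#}) = mon {#Yg, Yg, gammag#}"
  "d (mon {#ag, alphag#}) = mon {#Xg, Xg, alphag#}"
  "d (mon {#bg, alphag#}) = mon {#Xg, Yg, alphag#}"
  "d (mon {#cg, alphag#}) = mon {#Yg, Yg, alphag#}"
  "d (mon {#ag, gammag#}) = mon {#Xg, Xg, gammag#}"
  "d (mon {#bg, gammag#}) = mon {#Xg, Yg, gammag#}"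
  "d (mon {#cg, gammag#}) = mon {#Yg, Yg, gammag#}"
  "d (mon {#alphag, gammag#}) = 0"
  by (simp_all add: d_gen_mult mon_gens em_def less_eq_bgen_def)
    (simp_all add: gen_eq_mon mult_mon koszul_prod smult_simps add_mset_commute
      distrib_left distrib_right left_diff_distrib right_diff_distrib)

lemma set_mset_subset_C:
  "z \<in> C \<Longrightarrow> M \<in> support z \<Longrightarrow> set_mset M \<subseteq> GB"
  by (simp add: Lam_iff)

lemma mdeg_support: "homog n z \<Longrightarrow> M \<in> support z \<Longrightarrow> mdeg M = n"
  by (simp add: homog_iff)

lemma degree_2_eq:
  assumes "z \<in> C" "homog 2 z"
  obtains p q where "z = smult p eX + smult q eY"
proof -
  have "support z \<subseteq> set [{#Xg#}, {#Yg#}]"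
  proof
    fix M assume M: "M \<in> support z"
    obtain x where "M = {#x#}" "x \<in> GB" "gdeg x = 2"
      by (rule mdeg_2[OF set_mset_subset_C[OF assms(1) M] mdeg_support[OF assms(2) M]])
    then show "M \<in> set [{#Xg#}, {#Yg#}]" using gens_degree(1)[of x] by auto
  qed
  then obtain k where "z = (\<Sum>M\<leftarrow>[{#Xg#}, {#Yg#}]. smult (k M) (mon M))"
    by (rule fgca_expand_list) simp
  then show ?thesis using that by (simp add: gen_eq_mon)
qed

lemma cocycle_3_eq:
  assumes "z \<in> C" "homog 3 z" "d z = 0"
  obtains p q where "z = smult p ealpha + smult q egamma"
proof -
  let ?L = "[{#ag#}, {#bg#}, {#cg#}, {#alphag#}, {#gammag#}]"
  have "support z \<subseteq> set ?L"
  proof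
    fix M assume M: "M \<in> support z"
    obtain x where "M = {#x#}" "x \<in> GB" "gdeg x = 3"
      by (rule mdeg_3[OF set_mset_subset_C[OF assms(1) M] mdeg_support[OF assms(2) M]])
    then show "M \<in> set ?L" using gens_degree(2)[of x] by auto
  qed
  then obtain k where z: "z = (\<Sum>M\<leftarrow>?L. smult (k M) (mon M))"
    by (rule fgca_expand_list) simp
  have dz: "coeff (d z) N = 0" for N using assms(3) by simp
  \<comment> \<open>The differentials of \<open>ag\<close>, \<open>bg\<close> and \<open>cg\<close>
    are three different monomials.\<close>
  have "k {#ag#} = 0" "k {#bg#} = 0" "k {#cg#} = 0"
    using dz[of "{#Xg, Xg#}"] dz[of "{#Xg, Yg#}"] dz[of "{#Yg, Yg#}"]
    by (simp_all add: z d_degree_3 Lam_mon coeff_mon add_eq_conv_ex)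
  then show ?thesis using that z by (simp add: gen_eq_mon smult_simps)
qed

lemma cocycle_5_exact:
  assumes "z \<in> C" "homog 5 z" "d z = 0"
  shows "exact z"
proof -
  let ?L = "[{#hg#}, {#ig#}, {#tg (Suc 0)#}, {#tg 2#}, {#tg 3#}, {#tg 4#}, {#tg 5#}, {#tg 6#},
      {#tg 7#}, {#tg 8#}, {#tg 9#}, {#Xg, ag#}, {#Xg, bg#}, {#Xg, cg#}, {#Yg, ag#}, {#Yg, bg#},
      {#Yg, cg#}, {#Xg, alphag#}, {#Xg, gammag#}, {#Yg, alphag#}, {#Yg, gammag#}]"
  have "support z \<subseteq> set ?L"
  proof
    fix M assume M: "M \<in> support z"
    show "M \<in> set ?L"
      using set_mset_subset_C[OF assms(1) M] mdeg_support[OF assms(2) M]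
    proof (cases rule: mdeg_5)
      case (1 x)
      then show ?thesis using gens_degree(4)[of x] by auto
    next
      case (2 x y)
      then show ?thesis using gens_degree(1)[of x] gens_degree(2)[of y] by auto
    qed
  qed
  moreover have "distinct ?L" by (simp add: add_eq_conv_ex)
  ultimately obtain k where z: "z = (\<Sum>M\<leftarrow>?L. smult (k M) (mon M))"
    by (rule fgca_expand_list)
  have dz: "coeff (d z) N = 0" for N using assms(3) by simp
  note rules = z d_degree_5 Lam_mon coeff_mon add_eq_conv_ex
  \<comment> \<open>Each coefficient is read off at a monomial that occurs in no other differential
    of the table. Only the last two equations, at \<open>{#Xg, Xg, Yg#}\<close> and
    \<open>{#Xg, Yg, Yg#}\<close>, involve two unknowns.\<close>
  have "k {#hg#} = 0"
    using dz[of "{#Xg, eg#}"] by (simp add: rules)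
  moreover have "k {#ig#} = 0"
    using dz[of "{#Yg, fg#}"] by (simp add: rules)
  moreover have "k {#tg (Suc 0)#} = 0"
    using dz[of "{#alphag, gammag#}"] by (simp add: rules)
  moreover have "k {#tg 2#} = 0"
    using dz[of "{#Yg, sXalphag#}"] by (simp add: rules)
  moreover have "k {#tg 3#} = 0"
    using dz[of "{#Yg, sXgammag#}"] by (simp add: rules)
  moreover have "k {#tg 4#} = 0"
    using dz[of "{#ag, alphag#}"] by (simp add: rules)
  moreover have "k {#tg 5#} = 0"
    using dz[of "{#bg, alphag#}"] by (simp add: rules)
  moreover have "k {#tg 6#} = 0"
    using dz[of "{#cg, alphag#}"] by (simp add: rules)
  moreover have "k {#tg 7#} = 0"
    using dz[of "{#ag, gammag#}"] by (simp add: rules)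
  moreover have "k {#tg 8#} = 0"
    using dz[of "{#bg, gammag#}"] by (simp add: rules)
  moreover have "k {#tg 9#} = 0"
    using dz[of "{#cg, gammag#}"] by (simp add: rules)
  moreover have "k {#Xg, ag#} = 0"
    using dz[of "{#Xg, Xg, Xg#}"] by (simp add: rules)
  moreover have "k {#Yg, cg#} = 0"
    using dz[of "{#Yg, Yg, Yg#}"] by (simp add: rules)
  moreover have "k {#Xg, bg#} = - k {#Yg, ag#}"
    using dz[of "{#Xg, Xg, Yg#}"] by (simp add: rules)
  moreover have "k {#Xg, cg#} = - k {#Yg, bg#}"
    using dz[of "{#Xg, Yg, Yg#}"] by (simp add: rules)
  \<comment> \<open>What remains are multiples of \<open>d ee\<close> and \<open>d ef\<close>, and
    the products of \<open>eX\<close>, \<open>eY\<close> with \<alpha> and \<gamma>, which are the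
    differentials of the four generators \<open>s\<close>.\<close>
  ultimately have "z = d (smult (k {#Yg, ag#}) ee + smult (k {#Yg, bg#}) ef
      + smult (k {#Xg, alphag#}) esXalpha + smult (k {#Yg, alphag#}) esYalpha
      + smult (k {#Xg, gammag#}) esXgamma + smult (k {#Yg, gammag#}) esYgamma)"
    by (intro fgca_eqI) (simp add: z mon_gens less_eq_bgen_def algebra_simps)
  then show ?thesis by (rule exactI[rotated]) simp
qed

text \<open>The differentials of the generators in \<open>V\<^sup>6\<close> are only known to be independent modulo the
  coboundaries of \<open>A\<close>, so the part \<open>y\<close> of a cocycle which lies in \<open>A\<close> has to be shown to be closed
  before these generators can be excluded. The relation \<open>d t\<^sub>1 = m - \<alpha>\<gamma>\<close> then turns \<open>m\<close> into \<open>\<alpha>\<gamma>\<close>.\<close>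

lemma cocycle_6_eq:
  assumes "z \<in> C" "homog 6 z" "d z = 0"
  obtains c where "exact (z - smult c (ealpha * egamma))"
proof -
  interpret A: cdga GA d
    using constrA gdeg_ge_2_B by unfold_locales (auto simp: constructs_A_def)
  \<comment> \<open>Independence removes the generators of degree six in \<open>W\<close>.\<close>
  have z6: "z \<in> Lam (GA \<union> gens_below 6 (W_gens J))"
    using assms by (intro cocycle_below_degree) auto
  define y where "y = restrict (\<lambda>M. set_mset M \<subseteq> GA) z"
  define w where "w = restrict (\<lambda>M. \<not> set_mset M \<subseteq> GA) z"
  have zyw: "z = y + w" by (rule fgca_eqI) (simp add: y_def w_def)
  have yA: "y \<in> Lam GA" by (simp add: Lam_iff y_def)
  have yC: "y \<in> C" and wC: "w \<in> C" using assms(1) by (simp_all add: y_def w_def)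
  have y6: "homog 6 y" using assms(2) by (simp add: homog_iff y_def)
  let ?L = "[{#Xg, sXalphag#}, {#Xg, sYalphag#}, {#Yg, sXalphag#}, {#Yg, sYalphag#},
      {#Xg, sXgammag#}, {#Xg, sYgammag#}, {#Yg, sXgammag#}, {#Yg, sYgammag#}, {#ag, alphag#},
      {#bg, alphag#}, {#cg, alphag#}, {#ag, gammag#}, {#bg, gammag#}, {#cg, gammag#},
      {#alphag, gammag#}]"
  have "support w \<subseteq> set ?L"
  proof
    fix M assume "M \<in> support w"
    then have M: "M \<in> support z" "\<not> set_mset M \<subseteq> GA"
      by (auto simp: w_def split: if_splits)
    have below: "set_mset M \<subseteq> GA \<union> gens_below 6 (W_gens J)"
      using z6 M(1) by (simp add: Lam_iff)
    have m: "monomial M" using M(1) coeff_not_monomial[of M z] by auto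
    show "M \<in> set ?L"
      using set_mset_subset_C[OF assms(1) M(1)] mdeg_support[OF assms(2) M(1)]
    proof (cases rule: mdeg_6)
      case (1 x)
      then show ?thesis using below M(2) by (auto simp: gens_below_def)
    next
      case (2 x y)
      then show ?thesis using gens_degree(1)[of x] gens_degree(3)[of y] M(2) by auto
    next
      case (3 x y)
      have "x \<in> {ag, bg, cg, alphag, gammag}" "y \<in> {ag, bg, cg, alphag, gammag}"
        using 3 gens_degree(2) by blast+
      then show ?thesis using M(2) m unfolding 3(1)
        by (elim insertE emptyE) (simp_all add: add_mset_commute)
    next
      case (4 x y v)
      then show ?thesis using gens_degree(1)[of x] gens_degree(1)[of y] gens_degree(1)[of v] M(2)
        by auto
    qed
  qed
  moreover have "distinct ?L" by (simp add: add_eq_conv_ex)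
  ultimately obtain k where w: "w = (\<Sum>M\<leftarrow>?L. smult (k M) (mon M))"
    by (rule fgca_expand_list)
  \<comment> \<open>A is closed under \<open>d\<close>, so at a monomial with a factor outside A
    only \<open>w\<close> contributes to \<open>d z = 0\<close>.\<close>
  have dw: "coeff (d w) N = 0" if "\<not> set_mset N \<subseteq> GA" for N
  proof -
    have "coeff (d y) N = 0" using A.d_closed[OF yA] that by (auto simp: Lam_iff)
    moreover have "d y + d w = 0" using assms(3) yC wC by (simp add: zyw)
    ultimately show ?thesis by (metis add.left_neutral coeff_add coeff_zero)
  qed
  have W: "alphag \<notin> GA" "gammag \<notin> GA" by (simp_all add: V_gens_def)
  have w_rel: "k {#Xg, sXalphag#} = - k {#ag, alphag#}"
      "k {#Xg, sYalphag#} = - k {#Yg, sXalphag#} - k {#bg, alphag#}"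
      "k {#Yg, sYalphag#} = - k {#cg, alphag#}" "k {#Xg, sXgammag#} = - k {#ag, gammag#}"
      "k {#Xg, sYgammag#} = - k {#Yg, sXgammag#} - k {#bg, gammag#}"
      "k {#Yg, sYgammag#} = - k {#cg, gammag#}"
    using dw[of "{#Xg, Xg, alphag#}"] dw[of "{#Xg, Yg, alphag#}"] dw[of "{#Yg, Yg, alphag#}"]
        dw[of "{#Xg, Xg, gammag#}"] dw[of "{#Xg, Yg, gammag#}"] dw[of "{#Yg, Yg, gammag#}"]
    by (simp_all add: W w d_degree_6_W Lam_mon coeff_mon add_eq_conv_ex)
  \<comment> \<open>\<open>tg 4\<close> to \<open>tg 9\<close> match the products of
    \<open>ag\<close>, \<open>bg\<close>, \<open>cg\<close> with \<alpha> and \<gamma>;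
    \<open>tg 2\<close> and \<open>tg 3\<close> match the terms in \<open>eY * esXalpha\<close> and
    \<open>eY * esXgamma\<close>. By \<open>w_rel\<close> the rest of \<open>w\<close> then agrees,
    except for the multiple of \<alpha>\<gamma>.\<close>
  define p where "p = smult (k {#ag, alphag#}) (gen (tg 4))
      + smult (k {#bg, alphag#}) (gen (tg 5)) + smult (k {#cg, alphag#}) (gen (tg 6))
      + smult (k {#Yg, sXalphag#}) (gen (tg 2)) + smult (k {#ag, gammag#}) (gen (tg 7))
      + smult (k {#bg, gammag#}) (gen (tg 8)) + smult (k {#cg, gammag#}) (gen (tg 9))
      + smult (k {#Yg, sXgammag#}) (gen (tg 3))"
  have pC: "p \<in> C" by (simp add: p_def)
  have w_eq: "w = smult (k {#alphag, gammag#}) (ealpha * egamma) + d p"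
    by (intro fgca_eqI) (simp add: w w_rel p_def mon_gens less_eq_bgen_def algebra_simps)
  have "d w = 0" unfolding w_eq using pC by (simp add: d_gen_mult smult_simps)
  then have "d y = 0" using assms(3) yC wC by (simp add: zyw)
  have V6: "Vg 6 ` I 6 \<subseteq> GA" by (auto simp: V_gens_def)
  have yV: "y \<in> Lam (gens_below 6 GA)"
  proof (rule A.cocycle_without_new_generators
      [OF basis_V[of 6, OF order_refl] _ _ _ _ _ y6 \<open>d y = 0\<close>])
    show "gens_below 6 GA \<union> Vg 6 ` I 6 \<subseteq> GA" using V6 by (auto simp: gens_below_def)
    show "Vg 6 ` I 6 \<inter> gens_below 6 GA = {}" by (auto simp: gens_below_def)
    show "y \<in> Lam (gens_below 6 GA \<union> Vg 6 ` I 6)"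
      unfolding Lam_iff
    proof (intro allI impI subsetI)
      fix M x assume M: "coeff y M \<noteq> 0" "x \<in># M"
      then have "x \<in> GA" "mdeg M = 6" using yA y6 by (auto simp: Lam_iff homog_iff)
      moreover obtain N where "M = add_mset x N" using M(2) by (meson multi_member_split)
      ultimately have "x \<in> GA" "gdeg x \<le> 6" by auto
      then show "x \<in> gens_below 6 GA \<union> Vg 6 ` I 6"
        by (cases "gdeg x = 6") (auto simp: gens_below_def V_gens_def)
    qed
  qed (simp_all add: inj_def)
  let ?K = "[{#Xg, Xg, Xg#}, {#Xg, Xg, Yg#}, {#Xg, Yg, Yg#}, {#Yg, Yg, Yg#}, {#Xg, eg#},
      {#Xg, fg#}, {#Yg, eg#}, {#Yg, fg#}, {#ag, bg#}, {#ag, cg#}, {#bg, cg#}]"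
  have "support y \<subseteq> set ?K"
  proof
    fix M assume M: "M \<in> support y"
    have below: "set_mset M \<subseteq> gens_below 6 GA" using yV M by (simp add: Lam_iff)
    have W': "x \<notin> gens_below 6 GA"
      if "x \<in> {alphag, gammag, sXalphag, sYalphag, sXgammag, sYgammag}" for x
      using that by (auto simp: gens_below_def V_gens_def)
    have m: "monomial M" using M coeff_not_monomial[of M y] by auto
    show "M \<in> set ?K"
      using set_mset_subset_C[OF yC M] mdeg_support[OF y6 M]
    proof (cases rule: mdeg_6)
      case (1 x)
      then show ?thesis using below by (auto simp: gens_below_def)
    next
      case (2 x y)
      then show ?thesis using gens_degree(1)[of x] gens_degree(3)[of y] below W' by auto
    next
      case (3 x y)
      have "x \<in> {ag, bg, cg, alphag, gammag}" "y \<in> {ag, bg, cg, alphag, gammag}"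
        using 3 gens_degree(2) by blast+
      then show ?thesis using below W' m unfolding 3(1)
        by (elim insertE emptyE) (simp_all add: add_mset_commute)
    next
      case (4 x y v)
      then show ?thesis using gens_degree(1)[of x] gens_degree(1)[of y] gens_degree(1)[of v]
        by (auto simp: add_mset_commute)
    qed
  qed
  moreover have "distinct ?K" by (simp add: add_eq_conv_ex)
  ultimately obtain l where y: "y = (\<Sum>M\<leftarrow>?K. smult (l M) (mon M))"
    by (rule fgca_expand_list)
  have dy: "coeff (d y) N = 0" for N using \<open>d y = 0\<close> by simp
  have y_rel: "l {#ag, bg#} = l {#Xg, eg#}" "l {#ag, cg#} = l {#Yg, eg#}"
      "l {#Xg, fg#} = l {#Yg, eg#}" "l {#bg, cg#} = l {#Yg, fg#}"
    using dy[of "{#Xg, Yg, ag#}"] dy[of "{#Yg, Yg, ag#}"] dy[of "{#Xg, Yg, bg#}"]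
      dy[of "{#Yg, Yg, bg#}"]
    by (simp_all add: y d_degree_6 Lam_mon coeff_mon add_eq_conv_ex)
  \<comment> \<open>By \<open>y_rel\<close> the non-cubic part of \<open>y\<close> is a combination
    of \<open>d eh\<close>, \<open>d ei\<close> and \<open>em\<close>, and \<open>em\<close> equals
    \<alpha>\<gamma> plus \<open>d (gen (tg 1))\<close>. The four cubic monomials are the
    differentials of the last four products.\<close>
  define q where "q = smult (l {#Xg, eg#}) eh + smult (l {#Yg, fg#}) ei
      + smult (l {#Yg, eg#}) (gen (tg (Suc 0))) + smult (l {#Xg, Xg, Xg#}) (eX * ea)
      + smult (l {#Xg, Xg, Yg#}) (eX * eb) + smult (l {#Xg, Yg, Yg#}) (eX * ec)
      + smult (l {#Yg, Yg, Yg#}) (eY * ec)"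
  have qC: "q \<in> C" by (simp add: q_def)
  have y_eq: "y = smult (l {#Yg, eg#}) (ealpha * egamma) + d q"
    by (intro fgca_eqI)
      (simp add: y y_rel q_def d_gen_mult mon_gens em_def less_eq_bgen_def algebra_simps)
  have "z - smult (k {#alphag, gammag#} + l {#Yg, eg#}) (ealpha * egamma) = d p + d q"
    by (subst zyw, subst w_eq, subst y_eq) (simp add: smult_add_left)
  moreover have "exact (d p + d q)"
    using pC qC by (intro exact_closed(4) exactI[OF _ refl])
  ultimately show ?thesis using that by metis
qed

end

section \<open>Massey products on B\<close>

text \<open>The elements \<open>quad p q r s\<close> and \<open>sigma p q k l\<close> are primitives of \<open>lin p q * lin r s\<close> and
  \<open>lin p q * eta k l\<close>.\<close>

definition lin :: "rat \<Rightarrow> rat \<Rightarrow> bgen fgca" where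
  "lin p q = smult p eX + smult q eY"

definition eta :: "rat \<Rightarrow> rat \<Rightarrow> bgen fgca" where
  "eta k l = smult k ealpha + smult l egamma"

definition quad :: "rat \<Rightarrow> rat \<Rightarrow> rat \<Rightarrow> rat \<Rightarrow> bgen fgca" where
  "quad p q r s = smult (p * r) ea + smult (p * s + q * r) eb + smult (q * s) ec"

definition sigma :: "rat \<Rightarrow> rat \<Rightarrow> rat \<Rightarrow> rat \<Rightarrow> bgen fgca" where
  "sigma p q k l = smult (p * k) esXalpha + smult (q * k) esYalpha
     + smult (p * l) esXgamma + smult (q * l) esYgamma"

lemma quad_commute: "quad p q r s = quad r s p q"
  by (simp add: quad_def mult.commute add.commute)

lemma homog_lin: "homog 2 (lin p q)"
  and homog_eta: "homog 3 (eta p q)"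
  and homog_quad: "homog 3 (quad p q r s)"
  and homog_sigma: "homog 4 (sigma p q r s)"
  unfolding lin_def eta_def quad_def sigma_def
  by (intro homog_closed homog_genI; simp)+

lemma bar_low_degree [simp]:
  "bar (lin p q) = - lin p q" "bar (eta p q) = eta p q"
  "bar (quad p q r s) = quad p q r s" "bar (sigma p q r s) = - sigma p q r s"
  by (simp_all add: bar_even[OF homog_lin] bar_odd[OF homog_eta] bar_odd[OF homog_quad]
      bar_even[OF homog_sigma])

lemma lin_commute: "u * lin p q = lin p q * u"
  using gen_even_commute[of Xg u] gen_even_commute[of Yg u]
  by (simp add: lin_def distrib_left distrib_right)

lemma eta_quad: "eta k l * quad p q r s = - (quad p q r s * eta k l)"
proof -
  have ac: "gen x * gen y = - (gen y * gen x)"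
    if "x \<in> {alphag, gammag}" "y \<in> {ag, bg, cg}" for x y
    using that by (intro gen_odd_anticommute) auto
  show ?thesis
    by (intro fgca_eqI) (simp add: eta_def quad_def distrib_left distrib_right ac algebra_simps)
qed

text \<open>Being of even degree, \<open>Xg\<close> and \<open>Yg\<close> generate a polynomial
  ring. This is the absence of zero divisors required for normalising degrees.\<close>

lemma lin_mult_eq_0: "lin p q * lin r s = 0 \<Longrightarrow> lin p q = 0 \<or> lin r s = 0"
proof -
  assume eq: "lin p q * lin r s = 0"
  have "lin p q * lin r s = smult (p * r) (mon {#Xg, Xg#}) + smult (p * s + q * r) (mon {#Xg, Yg#})
      + smult (q * s) (mon {#Yg, Yg#})"
    by (intro fgca_eqI) (simp add: lin_def distrib_left distrib_right gen_mult_gen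
        add_mset_commute algebra_simps)
  then have "coeff (smult (p * r) (mon {#Xg, Xg#}) + smult (p * s + q * r) (mon {#Xg, Yg#})
      + smult (q * s) (mon {#Yg, Yg#})) M = 0" for M
    using eq by simp
  from this[of "{#Xg, Xg#}"] this[of "{#Xg, Yg#}"] this[of "{#Yg, Yg#}"]
  have "p * r = 0" "p * s + q * r = 0" "q * s = 0"
    by (simp_all add: coeff_mon add_eq_conv_ex)
  then have "(p = 0 \<and> q = 0) \<or> (r = 0 \<and> s = 0)" by auto
  then show ?thesis by (auto simp: lin_def smult_simps)
qed

context cdga_B
begin

lemma low_degree_mem [simp]: "lin p q \<in> C" "eta p q \<in> C" "quad p q r s \<in> C" "sigma p q r s \<in> C"
  by (simp_all add: lin_def eta_def quad_def sigma_def)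

lemma d_low_degree [simp]:
  "d (lin p q) = 0" "d (eta p q) = 0" "d (quad p q r s) = lin p q * lin r s"
  "d (sigma p q k l) = lin p q * eta k l"
  by (simp_all add: lin_def eta_def quad_def sigma_def smult_simps smult_add_left
      distrib_left distrib_right gen_even_commute[of Xg eY] mult.commute ac_simps)

lemma exact_quad_eta: "exact (quad p q r s * eta k l - lin p q * sigma r s k l)"
proof (rule exactI)
  \<comment> \<open>All terms match one of the given differentials except
    \<open>eb * ealpha - eY * esXalpha\<close>, with coefficient \<open>k * q * r\<close>, which is
    \<open>d (gen (tg 5)) - d (gen (tg 2))\<close>; the same pattern serves for \<gamma>.\<close>
  let ?t = "\<lambda>k i2 i4 i5 i6. smult (k * p * r) (gen (tg i4))
      + smult (k * p * s + k * q * r) (gen (tg i5))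
      - smult (k * q * r) (gen (tg i2)) + smult (k * q * s) (gen (tg i6))"
  show "quad p q r s * eta k l - lin p q * sigma r s k l = d (?t k 2 4 5 6 + ?t l 3 7 8 9)"
    by (intro fgca_eqI)
      (simp add: lin_def eta_def quad_def sigma_def distrib_left distrib_right algebra_simps)
qed simp

lemma exact_lin_sigma: "exact (lin p q * sigma r s k l - lin r s * sigma p q k l)"
proof (rule exactI)
  \<comment> \<open>The symmetric terms cancel. What is left is the determinant of the two linear
    forms times \<open>eY * esXalpha - eX * esYalpha\<close>, and likewise for \<gamma>.\<close>
  show "lin p q * sigma r s k l - lin r s * sigma p q k l
      = d (smult ((q * r - p * s) * k) (gen (tg 2)) + smult ((q * r - p * s) * l) (gen (tg 3)))"
    by (intro fgca_eqI) (simp add: lin_def sigma_def distrib_left distrib_right algebra_simps)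
qed simp

text \<open>\<open>bar\<close> is minus the identity in degree two and the identity in degree three,
  which dictates the signs of the primitives here and in the other two orders of the degrees. The
  resulting product is \<open>exact_quad_eta\<close> up to sign.\<close>

lemma triple_2_2_3:
  assumes "x 1 = cohom_class C d (lin p q)" "x 2 = cohom_class C d (lin r s)"
    "x 3 = cohom_class C d (eta k l)"
  shows "massey_vanishes C d 3 x"
proof (rule triple_massey_vanishesI[where p = "- quad p q r s" and q = "- sigma r s k l",
      OF _ _ _ _ _ homog_lin homog_lin homog_eta
        homog_closed(2)[OF homog_quad] homog_closed(2)[OF homog_sigma] _ _ _ assms])
  show "exact (bar (lin p q) * - sigma r s k l + bar (- quad p q r s) * eta k l)"
    using exact_closed(2)[OF exact_quad_eta[of p q r s k l]] by (simp add: algebra_simps)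
qed simp_all

lemma triple_2_3_2:
  assumes "x 1 = cohom_class C d (lin p q)" "x 2 = cohom_class C d (eta k l)"
    "x 3 = cohom_class C d (lin r s)"
  shows "massey_vanishes C d 3 x"
proof (rule triple_massey_vanishesI[where p = "- sigma p q k l" and q = "sigma r s k l",
      OF _ _ _ _ _ homog_lin homog_eta homog_lin
        homog_closed(2)[OF homog_sigma] homog_sigma _ _ _ assms])
  show "exact (bar (lin p q) * sigma r s k l + bar (- sigma p q k l) * lin r s)"
    using exact_lin_sigma[of r s p q k l]
    by (simp add: lin_commute[of "sigma p q k l"] algebra_simps)
qed (simp_all add: lin_commute[of "eta k l"])

lemma triple_3_2_2:
  assumes "x 1 = cohom_class C d (eta k l)" "x 2 = cohom_class C d (lin p q)"
    "x 3 = cohom_class C d (lin r s)"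
  shows "massey_vanishes C d 3 x"
proof (rule triple_massey_vanishesI[where p = "sigma p q k l" and q = "- quad p q r s",
      OF _ _ _ _ _ homog_eta homog_lin homog_lin homog_sigma
        homog_closed(2)[OF homog_quad] _ _ _ assms])
  show "exact (bar (eta k l) * - quad p q r s + bar (sigma p q k l) * lin r s)"
    using exact_quad_eta[of r s p q k l]
    by (simp add: eta_quad lin_commute[of "sigma p q k l"] quad_commute[of r s p q])
qed (simp_all add: lin_commute[of "eta k l"])

text \<open>The right-hand side represents, up to sign, a triple product of classes of degree two,
  and there is no cohomology in degree five.\<close>

lemma lin_quad_primitive:
  obtains b where "b \<in> C" "homog 4 b"
    "d b = lin p1 p2 * quad q1 q2 r1 r2 - quad p1 p2 q1 q2 * lin r1 r2"
proof -
  let ?z = "lin p1 p2 * quad q1 q2 r1 r2 - quad p1 p2 q1 q2 * lin r1 r2"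
  have h: "homog 5 ?z"
    by (intro homog_closed(4) homog_mult_eq[OF homog_lin homog_quad]
        homog_mult_eq[OF homog_quad homog_lin]) simp_all
  have "d ?z = 0"
    using d_mult_bar[OF _ _ homog_lin] d_mult_bar[OF _ _ homog_quad] by (simp add: mult.assoc)
  then have "exact ?z" by (intro cocycle_5_exact h) simp_all
  then show ?thesis using that h by (auto elim!: exact_homogE[of _ 4])
qed

text \<open>Adding multiples of \<open>\<alpha>\<close> and \<open>\<gamma>\<close> to the two outer entries of length two changes the product by
  any prescribed multiple of \<open>\<alpha>\<gamma>\<close>, which spans the cohomology of degree six.\<close>

lemma quadruple_2_2_2_2:
  assumes x: "x 1 = cohom_class C d (lin p1 p2)" "x 2 = cohom_class C d (lin q1 q2)"
    "x 3 = cohom_class C d (lin r1 r2)" "x 4 = cohom_class C d (lin s1 s2)"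
  shows "massey_vanishes C d 4 x"
proof -
  let ?u = "lin p1 p2" and ?v = "lin q1 q2" and ?w = "lin r1 r2" and ?y = "lin s1 s2"
  let ?uv = "quad p1 p2 q1 q2" and ?vw = "quad q1 q2 r1 r2" and ?wy = "quad r1 r2 s1 s2"
  obtain b where b: "b \<in> C" "homog 4 b" "d b = ?u * ?vw - ?uv * ?w" by (rule lin_quad_primitive)
  obtain c where c: "c \<in> C" "homog 4 c" "d c = ?v * ?wy - ?vw * ?y" by (rule lin_quad_primitive)
  \<comment> \<open>The quadruple product for the unmodified entries \<open>- ?uv\<close>,
    \<open>- ?vw\<close>, \<open>- ?wy\<close>, \<open>b\<close> and \<open>c\<close>.\<close>
  let ?z = "- (?u * c) + ?uv * ?wy - b * ?y"
  have zC: "?z \<in> C" using b c by simp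
  have "homog 6 ?z"
    using homog_mult[OF homog_lin c(2)] homog_mult[OF homog_quad homog_quad]
      homog_mult[OF b(2) homog_lin] by (intro homog_closed) simp_all
  moreover have "d ?z = 0"
    by (simp add: d_mult_bar[OF _ _ homog_lin] d_mult_bar[OF _ _ homog_quad]
        d_mult_bar[OF _ _ b(2)] b c) (simp add: algebra_simps)
  ultimately obtain t where t: "exact (?z - smult t (ealpha * egamma))"
    using cocycle_6_eq zC by blast
  \<comment> \<open>Adding \<alpha> to \<open>- ?uv\<close> and \<open>-t\<close> times \<gamma> to
    \<open>- ?wy\<close> contributes \<open>-t\<close> times \<alpha>\<gamma>, which cancels the
    class of \<open>?z\<close>. The \<open>sigma\<close> terms restore the equations for the entries
    of length three.\<close>
  let ?B = "b + sigma r1 r2 1 0" and ?C = "c + sigma q1 q2 0 t"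
  let ?P = "eta 1 0 - ?uv" and ?R = "- ?wy - eta 0 t"
  \<comment> \<open>Besides the corrected \<open>?z\<close> there are two cross terms, one for each
    added class, and each has the form treated by \<open>exact_quad_eta\<close>.\<close>
  have "bar ?u * ?C + bar ?P * ?R + bar ?B * ?y
      = (?z - smult t (ealpha * egamma)) + (?uv * eta 0 t - ?u * sigma q1 q2 0 t)
        + (quad s1 s2 r1 r2 * eta 1 0 - ?y * sigma r1 r2 1 0)"
  proof -
    have "eta 1 0 * eta 0 t = smult t (ealpha * egamma)"
      by (simp add: eta_def smult_simps)
    moreover have "bar b = - b" using b(2) by (simp add: bar_even)
    ultimately show ?thesis
      by (simp add: eta_quad lin_commute[of "sigma r1 r2 1 0"] quad_commute[of s1 s2 r1 r2]
          algebra_simps)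
  qed
  also have "exact \<dots>"
    by (intro exact_closed(4) t exact_quad_eta)
  finally have ex: "exact (bar ?u * ?C + bar ?P * ?R + bar ?B * ?y)" .
  have hom: "homog 3 ?P" "homog 3 (- ?vw)" "homog 3 ?R" "homog 4 ?B" "homog 4 ?C"
    using b c by (auto intro!: homog_closed homog_quad homog_eta homog_sigma)
  show ?thesis
  proof (rule quadruple_massey_vanishesI[OF _ _ _ _ _ _ _ _ _
        homog_lin homog_lin homog_lin homog_lin hom _ _ _ _ x _ _ _ _ _ ex])
    show "d ?B = bar ?u * - ?vw + bar ?P * ?w"
      using b by (simp add: lin_commute[of "eta 1 0"] algebra_simps)
    show "d ?C = bar ?v * ?R + bar (- ?vw) * ?y"
      using c by (simp add: algebra_simps)
  qed (use b c in simp_all)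
qed

theorem massey_vanishes_B:
  assumes m: "m \<ge> 3" and a: "defining_system C d m x a"
  shows "massey_vanishes C d m x"
proof (cases "\<exists>i<m. exact (a i (Suc i))")
  case True
  then show ?thesis using massey_vanishes_zero_class[OF a] by blast
next
  case False
  then have nex: "\<not> exact (a i (Suc i))" if "i < m" for i using that by blast
  have ne: "(i, Suc i) \<noteq> (0, m)" for i using m by auto
  have aC: "a i (Suc i) \<in> C" if "i < m" for i
    using defining_systemD(1)[OF a, of i "Suc i"] that ne by simp
  have "\<exists>k. homog k (a i (Suc i))" if "i < m" for i
    using defining_systemD(2)[OF a, of i "Suc i"] that ne by simp
  then obtain n' where n': "homog (n' i) (a i (Suc i))" if "i < m" for i by metis
  \<comment> \<open>Shifted so that \<open>n k\<close> is the degree of the class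
    \<open>x k\<close>, whose representative is \<open>a (k - 1) k\<close>.\<close>
  define n where "n k = n' (k - 1)" for k
  have hom: "homog (n (Suc i)) (a i (Suc i))" if "i < m" for i
    using n'[OF that] by (simp add: n_def)
  have nz: "a i (Suc i) \<noteq> 0" if "i < m" for i using nex[OF that] exact_closed(1) by metis
  have n2: "2 \<le> n k" if k: "k \<in> {1..m}" for k
  proof -
    obtain i where i: "k = Suc i" "i < m" using k by (cases k) auto
    have "n k \<noteq> 0" using exact_neighbour[OF a m i(2)] hom[OF i(2)] i nex by metis
    moreover have "n k \<noteq> 1" using homog_1_eq[OF aC[OF i(2)]] hom[OF i(2)] nz[OF i(2)] i by metis
    ultimately show ?thesis by simp
  qed
  have no_zero_div: "u = 0 \<or> v = 0"
    if uv: "u \<in> C" "v \<in> C" "homog 2 u" "homog 2 v" "u * v = 0" for u v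
  proof -
    obtain p q where u: "u = lin p q" using degree_2_eq[OF uv(1,3)] unfolding lin_def by blast
    obtain r s where v: "v = lin r s" using degree_2_eq[OF uv(2,4)] unfolding lin_def by blast
    show ?thesis using lin_mult_eq_0 uv(5) unfolding u v by blast
  qed
  obtain a' where a': "defining_system C d m x a'" and deg:
      "\<And>i j. i < j \<Longrightarrow> j \<le> m \<Longrightarrow> (i, j) \<noteq> (0, m) \<Longrightarrow> homog (excess n i j + 1) (a' i j)"
    by (rule defining_system_expected_degrees[OF a m, of n])
      (assumption | erule hom n2 nz no_zero_div cocycle_ge_7_exact | erule that)+
  let ?z = "\<Sum>l\<in>{0<..<m}. bar (a' 0 l) * a' l m"
  have zC: "?z \<in> C"
    using defining_systemD(1)[OF a'] by (intro Lam_sum Lam_mult Lam_closed) auto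
  have zh: "homog (excess n 0 m + 2) ?z"
  proof (rule homog_sum)
    fix l assume l: "l \<in> {0<..<m}"
    have "excess n 0 m = excess n 0 l + excess n l m" using l by (intro excess_split) auto
    then show "homog (excess n 0 m + 2) (bar (a' 0 l) * a' l m)"
      using deg[of 0 l] deg[of l m] l by (intro homog_mult_eq[OF homog_closed(6)]) auto
  qed
  have dz: "d ?z = 0" by (rule massey_sum_closed_of_defining_system[OF a'])
  have E: "m - 0 \<le> excess n 0 m" using n2 by (intro excess_ge) auto
  \<comment> \<open>The product has degree \<open>excess n 0 m + 2\<close>, so the cases are degree
    five, six and at least seven.\<close>
  consider "excess n 0 m = 3" | "excess n 0 m = 4" | "5 \<le> excess n 0 m" using E m by linarith
  then show ?thesis
  proof cases
    case 1
    then have "exact ?z" using zC zh dz by (intro cocycle_5_exact) simp_all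
    then show ?thesis by (rule massey_vanishesI[OF a'])
  next
    case 3
    then have "exact ?z"
      using zC zh dz by (intro cocycle_ge_7_exact[of "excess n 0 m + 2"]) simp_all
    then show ?thesis by (rule massey_vanishesI[OF a'])
  next
    case 2
    \<comment> \<open>In degree six the given system need not give 0. Only the classes are retained,
      with representatives of the form \<open>lin p q\<close> or \<open>eta p q\<close>, from which
      new systems are built.\<close>
    have x: "x (Suc i) = cohom_class C d (a i (Suc i))" and da: "d (a i (Suc i)) = 0"
      if "i < m" for i
      using defining_systemD(3,4)[OF a that] by simp_all
    have deg2: "\<exists>p q. x (Suc i) = cohom_class C d (lin p q)" if "i < m" "n (Suc i) = 2" for i
      using degree_2_eq[OF aC[OF that(1)]] hom[OF that(1)] x[OF that(1)] that(2)
      unfolding lin_def by metis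
    have deg3: "\<exists>p q. x (Suc i) = cohom_class C d (eta p q)" if "i < m" "n (Suc i) = 3" for i
      using cocycle_3_eq[OF aC[OF that(1)]] hom[OF that(1)] x[OF that(1)] da[OF that(1)] that(2)
      unfolding eta_def by metis
    consider "m = 3" | "m = 4" using E 2 m by linarith
    then show ?thesis
    proof cases
      case 1
      have "{0<..3} = {1, 2, 3 :: nat}" by auto
      then have "(n 1 - 1) + (n 2 - 1) + (n 3 - 1) = 4" using 1 2 by (simp add: excess_def)
      \<comment> \<open>Three positive numbers with sum four: one of them is two and the others are
        one.\<close>
      then consider "n 1 = 2" "n 2 = 2" "n 3 = 3" | "n 1 = 2" "n 2 = 3" "n 3 = 2"
        | "n 1 = 3" "n 2 = 2" "n 3 = 2"
        using n2[of 1] n2[of 2] n2[of 3] 1 by fastforce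
      then show ?thesis
      proof cases
        case 1
        then show ?thesis
          using deg2[of 0] deg2[of 1] deg3[of 2] triple_2_2_3 \<open>m = 3\<close> by (auto simp: numeral_eq_Suc)
      next
        case 2
        then show ?thesis
          using deg2[of 0] deg3[of 1] deg2[of 2] triple_2_3_2 \<open>m = 3\<close> by (auto simp: numeral_eq_Suc)
      next
        case 3
        then show ?thesis
          using deg3[of 0] deg2[of 1] deg2[of 2] triple_3_2_2 \<open>m = 3\<close> by (auto simp: numeral_eq_Suc)
      qed
    next
      case m4: 2
      have "{0<..4} = {1, 2, 3, 4 :: nat}" by auto
      then have "(n 1 - 1) + (n 2 - 1) + (n 3 - 1) + (n 4 - 1) = 4"
        using m4 2 by (simp add: excess_def)
      then have "n 1 = 2" "n 2 = 2" "n 3 = 2" "n 4 = 2"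
        using n2[of 1] n2[of 2] n2[of 3] n2[of 4] m4 by auto
      then show ?thesis
        using deg2[of 0] deg2[of 1] deg2[of 2] deg2[of 3] quadruple_2_2_2_2 m4
        by (auto simp: numeral_eq_Suc)
    qed
  qed
qed

end

theorem corollary4p12:
  fixes I J :: "nat \<Rightarrow> nat set"
    and d :: "bgen fgca \<Rightarrow> bgen fgca"
    and B :: "bgen fgca set"
    and m :: nat
    and x :: "nat \<Rightarrow> bgen fgca set"
  defines "B \<equiv> Lam (V_gens I \<union> W_gens J)"
  assumes "constructs_B I J d"
    and "m \<ge> 3"
    and "\<And>i. i \<in> {1..m} \<Longrightarrow> x i \<in> homog_classes B d"
    and "massey_defined B d m x"
  shows "massey_vanishes B d m x"
proof -
  interpret cdga_B I J d using assms(2) by unfold_locales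
  obtain a where "defining_system B d m x a"
    using assms(5) by (auto simp: massey_defined_def)
  then show ?thesis using massey_vanishes_B[OF assms(3)] unfolding B_def by blast
qed

end
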